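(* Let $p$ be a prime, let $G$ be a finite nonabelian group and let $A$ be a finite abelian $p$-group of exponent $p^3$. If $C(G)=C(A)$, then $p=2$.
   Context: All groups are finite. ${\rm Irr}(G)$ denotes the set of complex irreducible characters of $G$. For $\chi\in{\rm Irr}(G)$ the codegree of $\chi$ is ${\rm cod}\,\chi=\frac{|G:\ker\chi|}{\chi(1)}$, and ${\rm Cod}(G)=\{{\rm cod}\,\chi\mid\chi\in{\rm Irr}(G)\}$. The group pseudo-algebra of $G$ is $C(G)=\{(d,m_G(d))\mid d\in{\rm Cod}(G)\}$, where $m_G(d)$ is the number of irreducible characters of $G$ with codegree $d$. *)

theory Defs
  imports
    "HOL-Algebra.Algebra"
    "HOL-Computational_Algebra.Primes"
    "Jordan_Normal_Form.VS_Connect"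
begin

definition GL :: "nat \<Rightarrow> complex mat monoid" where
  "GL n = units_of (ring_mat TYPE(complex) n ())"

definition is_representation ::
  "('a, 'm) monoid_scheme \<Rightarrow> nat \<Rightarrow> ('a \<Rightarrow> complex mat) \<Rightarrow> bool" where
  "is_representation G n \<rho> \<longleftrightarrow> \<rho> \<in> hom G (GL n)"

definition is_irreducible_representation ::
  "('a, 'm) monoid_scheme \<Rightarrow> nat \<Rightarrow> ('a \<Rightarrow> complex mat) \<Rightarrow> bool" where
  "is_irreducible_representation G n \<rho> \<longleftrightarrow>
     is_representation G n \<rho> \<and> n > 0 \<and>
     (\<forall>W. subspace class_ring W (module_vec TYPE(complex) n) \<longrightarrow>
          (\<forall>g \<in> carrier G. \<forall>w \<in> W. \<rho> g *\<^sub>v w \<in> W) \<longrightarrow>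
          W = {0\<^sub>v n} \<or> W = carrier_vec n)"

(* Characters are made undefined outside the carrier, so that distinct elements of Irr G
   are distinct as functions on the group and Irr G can be counted. *)
definition character_of ::
  "('a, 'm) monoid_scheme \<Rightarrow> ('a \<Rightarrow> complex mat) \<Rightarrow> 'a \<Rightarrow> complex" where
  "character_of G \<rho> = (\<lambda>g \<in> carrier G. sum_list (diag_mat (\<rho> g)))"

definition Irr :: "('a, 'm) monoid_scheme \<Rightarrow> ('a \<Rightarrow> complex) set" where
  "Irr G = {character_of G \<rho> | n \<rho>. is_irreducible_representation G n \<rho>}"

definition char_ker :: "('a, 'm) monoid_scheme \<Rightarrow> ('a \<Rightarrow> complex) \<Rightarrow> 'a set" where
  "char_ker G \<chi> = {g \<in> carrier G. \<chi> g = \<chi> \<one>\<^bsub>G\<^esub>}"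

(* The codegree is a positive integer; it is kept complex because character values are. *)
definition cod :: "('a, 'm) monoid_scheme \<Rightarrow> ('a \<Rightarrow> complex) \<Rightarrow> complex" where
  "cod G \<chi> = of_nat (card (rcosets\<^bsub>G\<^esub> (char_ker G \<chi>))) / \<chi> \<one>\<^bsub>G\<^esub>"

definition Cod :: "('a, 'm) monoid_scheme \<Rightarrow> complex set" where
  "Cod G = cod G ` Irr G"

definition cod_multiplicity :: "('a, 'm) monoid_scheme \<Rightarrow> complex \<Rightarrow> nat" where
  "cod_multiplicity G d = card {\<chi> \<in> Irr G. cod G \<chi> = d}"

definition group_pseudo_algebra :: "('a, 'm) monoid_scheme \<Rightarrow> (complex \<times> nat) set" where
  "group_pseudo_algebra G = {(d, cod_multiplicity G d) | d. d \<in> Cod G}"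

definition is_p_group :: "nat \<Rightarrow> ('a, 'm) monoid_scheme \<Rightarrow> bool" where
  "is_p_group p G \<longleftrightarrow> group G \<and> (\<exists>k. Coset.order G = p ^ k)"

definition group_exponent :: "('a, 'm) monoid_scheme \<Rightarrow> nat" where
  "group_exponent G = (LEAST n. n > 0 \<and> (\<forall>x \<in> carrier G. x [^]\<^bsub>G\<^esub> n = \<one>\<^bsub>G\<^esub>))"

end

theory Submission
  imports
    Defs
    "Jordan_Normal_Form.DL_Rank"
    "Jordan_Normal_Form.Spectral_Radius"
begin

text \<open>If every codegree of \<open>G\<close> is prime to a prime \<open>q\<close>, then \<open>q\<close> does not divide \<open>|G|\<close>: let \<open>N\<close> be the
  least normal subgroup of index prime to \<open>q\<close>; every irreducible character whose kernel does not
  contain \<open>N\<close> has degree divisible by \<open>q\<close>, so \<open>|G| = \<Sum> \<chi>(1)\<^sup>2\<close> is congruent to \<open>|G : N|\<close> modulo \<open>q\<close>.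
  As the codegrees of \<open>A\<close> are \<open>p ^ i\<close> with \<open>i \<le> 3\<close>, it follows that \<open>|G| = p ^ m\<close>, and
  \<open>\<chi>(1)\<^sup>2 < |G : ker \<chi>| = \<chi>(1) cod \<chi>\<close> for nontrivial \<open>\<chi>\<close> leaves only the degrees \<open>1\<close>, \<open>p\<close>, \<open>p\<^sup>2\<close>.
  If these occur \<open>x0\<close>, \<open>x1\<close>, \<open>x2\<close> times, then \<open>x0 + x1 + x2 = |A| = p ^ n\<close> and
  \<open>x0 + p\<^sup>2 x1 + p\<^sup>4 x2 = p ^ m\<close>, whence \<open>n < m < n + 4\<close>. For odd \<open>p\<close> no nontrivial irreducible
  character is real, so \<open>x1\<close> and \<open>x2\<close> are even, which is incompatible with
  \<open>p ^ m - p ^ n = (p\<^sup>2 - 1)(x1 + (p\<^sup>2 + 1) x2)\<close>.\<close>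

section \<open>Traces and block triangular form\<close>

text \<open>The pseudo-algebra is used through two facts: each codegree of \<open>G\<close> is some
  \<open>p ^ i\<close> with \<open>i \<le> 3\<close>, and \<open>G\<close> and \<open>A\<close> have
  equally many irreducible characters. An integral codegree makes \<open>\<chi> \<one>\<close> a
  divisor of the index of \<open>char_ker G \<chi>\<close>, hence of the order of \<open>G\<close>;
  this is how the degrees become powers of \<open>p\<close>. The exponent enters through the
  characters of \<open>A\<close>, whose values are \<open>p ^ 3\<close>-th roots of unity. All sums
  of squares of degrees have one source, the regular character of a quotient by a normal subgroup
  \<open>N\<close>, inflated to \<open>G\<close>: trivial \<open>N\<close> gives the order of
  \<open>G\<close>, \<open>N = char_ker G \<chi>\<close> the bound on the degree, and the
  \<open>N\<close> belonging to \<open>q\<close> the congruence. The order of \<open>G\<close> is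
  not given, and the bounds on \<open>m\<close> reduce the final equation to three cases. With
  \<open>T = x1 + (p\<^sup>2 + 1) x2\<close> they read \<open>p ^ n = (p + 1) T\<close>,
  \<open>p ^ n = T\<close> and \<open>p ^ n (p\<^sup>2 + p + 1) = (p + 1) T\<close>, each with an
  odd left side and an even right side.\<close>

lemma subspace_module_vec_iff:
  "subspace class_ring W (module_vec TYPE('a :: field) n) \<longleftrightarrow>
     W \<subseteq> carrier_vec n \<and> 0\<^sub>v n \<in> W \<and> (\<forall>v\<in>W. \<forall>w\<in>W. v + w \<in> W) \<and> (\<forall>c. \<forall>v\<in>W. c \<cdot>\<^sub>v v \<in> W)"
  unfolding VectorSpace.subspace_def submodule_def
  using vec_vs[where 'a = 'a and n = n] vec_module[where 'a = 'a and n = n]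
  by (auto simp: module_vec_simps class_ring_simps)

definition mtrace :: "'a :: comm_monoid_add mat \<Rightarrow> 'a" where
  "mtrace M = (\<Sum>i<dim_row M. M $$ (i, i))"

lemma sum_list_diag_mat: "sum_list (diag_mat M) = mtrace M"
  by (simp add: mtrace_def diag_mat_def interv_sum_list_conv_sum_set_nat atLeast0LessThan)

lemma mult_mat_entry:
  assumes "A \<in> carrier_mat n m" "B \<in> carrier_mat m k" "i < n" "j < k"
  shows "(A * B) $$ (i, j) = (\<Sum>l<m. A $$ (i, l) * B $$ (l, j))"
  using assms by (auto simp: scalar_prod_def atLeast0LessThan intro!: sum.cong)

lemma mtrace_mult_commute:
  fixes A B :: "'a :: comm_semiring_0 mat"
  assumes "A \<in> carrier_mat n m" "B \<in> carrier_mat m n"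
  shows "mtrace (A * B) = mtrace (B * A)"
proof -
  have "mtrace (A * B) = (\<Sum>i<n. \<Sum>l<m. A $$ (i, l) * B $$ (l, i))"
    unfolding mtrace_def using assms by (auto simp: mult_mat_entry simp del: index_mult_mat(1))
  also have "\<dots> = (\<Sum>l<m. \<Sum>i<n. B $$ (l, i) * A $$ (i, l))"
    by (subst sum.swap) (simp add: mult.commute)
  also have "\<dots> = mtrace (B * A)"
    unfolding mtrace_def using assms by (auto simp: mult_mat_entry simp del: index_mult_mat(1))
  finally show ?thesis .
qed

lemma mtrace_conj:
  fixes A P Q :: "'a :: comm_semiring_1 mat"
  assumes "A \<in> carrier_mat n n" "P \<in> carrier_mat n m" "Q \<in> carrier_mat m n" "P * Q = 1\<^sub>m n"
  shows "mtrace (Q * A * P) = mtrace A"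
proof -
  have "mtrace (Q * A * P) = mtrace (Q * (A * P))" using assms by (simp add: assoc_mult_mat)
  also have "\<dots> = mtrace (A * P * Q)" using assms by (subst mtrace_mult_commute) auto
  also have "\<dots> = mtrace A" using assms by (simp add: assoc_mult_mat)
  finally show ?thesis .
qed

lemma mtrace_one [simp]: "mtrace (1\<^sub>m n :: 'a :: semiring_1 mat) = of_nat n"
  by (simp add: mtrace_def)

lemma mtrace_smult: "mtrace (c \<cdot>\<^sub>m A) = c * mtrace (A :: 'a :: comm_ring_1 mat)"
  if "A \<in> carrier_mat n n"
  using that by (auto simp add: mtrace_def sum_distrib_left)

text \<open>Conjugation by \<open>P\<close> turns \<open>W\<close> into the span of the first
  \<open>k\<close> coordinate vectors, so matrices preserving \<open>W\<close> become block
  triangular. The strict bounds on \<open>k\<close> make both diagonal blocks smaller than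
  \<open>n\<close>, as an induction on the degree requires.\<close>

lemma adapted_basis:
  fixes W :: "'a :: field vec set"
  assumes W: "subspace class_ring W (module_vec TYPE('a) n)"
    and ne0: "W \<noteq> {0\<^sub>v n}" and ne1: "W \<noteq> carrier_vec n"
  obtains k P Q where "0 < k" "k < n" "P \<in> carrier_mat n n" "Q \<in> carrier_mat n n"
    "P * Q = 1\<^sub>m n" "Q * P = 1\<^sub>m n" "\<And>j. j < k \<Longrightarrow> col P j \<in> W"
    "\<And>w i. w \<in> W \<Longrightarrow> k \<le> i \<Longrightarrow> i < n \<Longrightarrow> (Q *\<^sub>v w) $ i = 0"
proof -
  interpret vec_space "TYPE('a)" n .
  note Wd = W[unfolded subspace_module_vec_iff]
  have bound: "finite S \<and> card S \<le> n" if "S \<subseteq> carrier_vec n \<and> lin_indpt S" for S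
    using that li_le_dim[of S] dim_is_n fin_dim by auto
  have empty_li: "lin_indpt {}" by (auto simp: lin_dep_def)
  \<comment> \<open>A maximal independent subset of \<open>W\<close> is a basis of \<open>W\<close>;
    it exists because independent sets have at most \<open>n\<close> elements.\<close>
  have "\<exists>B. finite B \<and> maximal B (\<lambda>S. S \<subseteq> W \<and> lin_indpt S)"
    by (rule maximal_exists[of _ n "{}"]) (use bound Wd empty_li in auto)
  then obtain B where B: "finite B" "maximal B (\<lambda>S. S \<subseteq> W \<and> lin_indpt S)" by auto
  hence BW: "B \<subseteq> W" and Bli: "lin_indpt B" by (auto simp: maximal_def)
  have Bc: "B \<subseteq> carrier_vec n" using BW Wd by auto
  have WB: "W \<subseteq> span B"
  proof
    fix w assume w: "w \<in> W"
    show "w \<in> span B"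
    proof (rule ccontr)
      assume n: "w \<notin> span B"
      hence "w \<notin> B" using Bc in_own_span by auto
      moreover have wc: "w \<in> carrier_vec n" using w Wd by auto
      ultimately have "lin_indpt (B \<union> {w})" using lin_dep_iff_in_span[of B w] Bc Bli n by auto
      moreover have "B \<union> {w} = B" if "lin_indpt (B \<union> {w})"
        using B(2) that w BW unfolding maximal_def by (elim conjE allE[of _ "B \<union> {w}"]) auto
      ultimately show False using \<open>w \<notin> B\<close> by auto
    qed
  qed
  have "span B \<subseteq> W"
    using W BW span_is_subset[of B W] by (auto simp: VectorSpace.subspace_def)
  with WB have WB: "W = span B" by auto
  \<comment> \<open>Maximal among the independent sets containing \<open>B\<close>, hence among all
    of them, since any larger one contains \<open>B\<close> too.\<close>
  have "\<exists>C. finite C \<and> maximal C (\<lambda>S. (S \<subseteq> carrier_vec n \<and> lin_indpt S) \<and> B \<subseteq> S)"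
    by (rule maximal_exists[of _ n B]) (use bound Bc Bli in auto)
  then obtain C where Cf: "finite C"
    and Cm: "maximal C (\<lambda>S. (S \<subseteq> carrier_vec n \<and> lin_indpt S) \<and> B \<subseteq> S)" by auto
  hence C: "C \<subseteq> carrier_vec n" "lin_indpt C" "B \<subseteq> C" by (simp_all add: maximal_def)
  have "S = C" if "S \<subseteq> carrier_vec n" "lin_indpt S" "C \<subseteq> S" for S
    using Cm that C(3) by (simp add: maximal_def)
  with C have "maximal C (\<lambda>S. S \<subseteq> carrier_vec n \<and> lin_indpt S)"
    by (simp add: maximal_def)
  hence bC: "basis C" using max_li_is_basis by auto
  hence cardC: "card C = n" using dim_basis[OF Cf] dim_is_n by auto
  have "B \<noteq> C" using WB ne1 bC unfolding basis_def by auto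
  have "B \<noteq> {}" using WB ne0 span_empty by auto
  obtain bs where bs: "set bs = B" "distinct bs" using finite_distinct_list[OF B(1)] by auto
  obtain cs where cs: "set cs = C - B" "distinct cs" using finite_distinct_list[of "C - B"] Cf by auto
  define k where "k = length bs"
  have k: "k = card B" using bs distinct_card unfolding k_def by metis
  have "k > 0" using k B(1) \<open>B \<noteq> {}\<close> by (simp add: card_gt_0_iff)
  have "k < n" using k psubset_card_mono[OF Cf] \<open>B \<noteq> C\<close> C(3) cardC by auto
  \<comment> \<open>The vectors of \<open>B\<close> come first, so the first \<open>k\<close>
    columns of \<open>P\<close> form a basis of \<open>W\<close>.\<close>
  define P where "P = mat_of_cols n (bs @ cs)"
  have sc: "set (bs @ cs) = C" using bs cs C by auto
  have len: "length (bs @ cs) = n"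
    using distinct_card[of "bs @ cs"] bs cs sc cardC by auto
  have Pc: "P \<in> carrier_mat n n" unfolding P_def using len mat_of_cols_carrier(1) by metis
  have colsP: "cols P = bs @ cs" unfolding P_def using C(1) sc by (intro cols_mat_of_cols) auto
  have "det P \<noteq> 0"
  proof
    assume "det P = 0"
    then obtain v where "v \<in> carrier_vec n" "v \<noteq> 0\<^sub>v n" "P *\<^sub>v v = 0\<^sub>v n"
      using det_0_iff_vec_prod_zero[OF Pc] by auto
    hence "lin_dep (set (cols P))" using bs cs by (intro lin_depI[OF Pc]) (auto simp: colsP)
    thus False using C(2) sc colsP by simp
  qed
  then obtain Q where Q: "Q \<in> carrier_mat n n" "Q * P = 1\<^sub>m n"
    using det_non_zero_imp_unit[OF Pc] unfolding Units_def ring_mat_simps by auto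
  have PQ: "P * Q = 1\<^sub>m n" using mat_mult_left_right_inverse[OF Q(1) Pc Q(2)] .
  have colW: "col P j \<in> W" if "j < k" for j
  proof -
    have "col P j = cols P ! j" using that \<open>k < n\<close> Pc by auto
    also have "\<dots> = bs ! j" using that colsP by (simp add: k_def nth_append)
    also have "\<dots> \<in> B" using that bs k_def by auto
    finally show ?thesis using BW by auto
  qed
  have Qw: "(Q *\<^sub>v w) $ i = 0" if w: "w \<in> W" and i: "k \<le> i" "i < n" for w i
  proof -
    define P1 where "P1 = mat_of_cols n bs"
    have P1: "P1 \<in> carrier_mat n k" unfolding P1_def k_def by auto
    have "cols P1 = bs" unfolding P1_def using Bc bs by (intro cols_mat_of_cols) auto
    hence "w \<in> col_space P1" using w WB bs unfolding col_space_def by simp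
    then obtain x where x: "x \<in> carrier_vec k" "P1 *\<^sub>v x = w"
      using col_space_eq[OF P1] P1 by auto
    \<comment> \<open>Coordinates of \<open>w\<close> with respect to \<open>bs\<close>, padded by
      zeros: \<open>P\<close> sends \<open>u\<close> to \<open>w\<close>, so \<open>Q\<close>
      returns \<open>u\<close>.\<close>
    define u where "u = vec n (\<lambda>i. if i < k then x $ i else 0)"
    have u: "u \<in> carrier_vec n" unfolding u_def by auto
    have "P *\<^sub>v u = P1 *\<^sub>v x"
    proof (rule eq_vecI)
      show "dim_vec (P *\<^sub>v u) = dim_vec (P1 *\<^sub>v x)" using Pc P1 by auto
      fix r assume "r < dim_vec (P1 *\<^sub>v x)"
      hence r: "r < n" using P1 by auto
      have "(P *\<^sub>v u) $ r = (\<Sum>l<n. P $$ (r, l) * u $ l)"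
        using r Pc u by (auto simp: scalar_prod_def atLeast0LessThan intro!: sum.cong)
      also have "\<dots> = (\<Sum>l<k. P $$ (r, l) * u $ l)"
        using \<open>k < n\<close> by (intro sum.mono_neutral_right) (auto simp: u_def)
      also have "\<dots> = (\<Sum>l<k. P1 $$ (r, l) * x $ l)"
        using \<open>k < n\<close> r len unfolding P_def P1_def
        by (intro sum.cong) (auto simp: u_def k_def mat_of_cols_index nth_append)
      also have "\<dots> = (P1 *\<^sub>v x) $ r"
        using r P1 x by (auto simp: scalar_prod_def atLeast0LessThan intro!: sum.cong)
      finally show "(P *\<^sub>v u) $ r = (P1 *\<^sub>v x) $ r" .
    qed
    hence "Q *\<^sub>v w = Q *\<^sub>v (P *\<^sub>v u)" using x by simp
    also have "\<dots> = u" using Q Pc u by (metis assoc_mult_mat_vec one_mult_mat_vec)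
    finally show ?thesis using i by (simp add: u_def)
  qed
  show thesis
    by (rule that[OF \<open>k > 0\<close> \<open>k < n\<close> Pc Q(1) PQ Q(2)]) (use colW Qw in auto)
qed

text \<open>The eigenvalues are roots of unity summing to their number, so all of them are 1 and
  \<open>\<Sum>i<k. M ^ i\<close> has determinant \<open>k ^ n\<close>, while it is annihilated by \<open>M - 1\<close>.\<close>
lemma finite_order_mtrace_eq_dim:
  fixes M :: "complex mat"
  assumes M: "M \<in> carrier_mat n n" and k: "k > 0" "M ^\<^sub>m k = 1\<^sub>m n" and tr: "mtrace M = of_nat n"
  shows "M = 1\<^sub>m n"
proof -
  obtain as where "char_poly M = (\<Prod>a\<leftarrow>as. [:- a, 1:])"
    using char_poly_factorized[OF M] by auto
  from schur_decomposition_exists[OF M this] obtain B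
    where B: "B \<in> carrier_mat n n" "upper_triangular B" "similar_mat M B" by auto
  then obtain P Q where PQ: "similar_mat_wit M B P Q" unfolding similar_mat_def by auto
  note w = similar_mat_witD2[OF M PQ]
  have Bk: "B ^\<^sub>m k = 1\<^sub>m n"
  proof -
    have "B ^\<^sub>m k = Q * (M ^\<^sub>m k) * P"
      using similar_mat_wit_pow[OF similar_mat_wit_sym[OF PQ], of k]
      unfolding similar_mat_wit_def Let_def by auto
    thus ?thesis using k w by simp
  qed
  have trB: "mtrace B = of_nat n"
    using mtrace_conj[of B n Q n P] w tr by simp
  \<comment> \<open>Serves twice: the eigenvalues are roots of unity, and the sum of the powers is
    triangular, so its determinant can be read off.\<close>
  have ut: "upper_triangular (B ^\<^sub>m j) \<and> B ^\<^sub>m j \<in> carrier_mat n n \<and> (\<forall>i<n. (B ^\<^sub>m j) $$ (i, i) = (B $$ (i, i)) ^ j)" for j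
  proof (induct j)
    case 0 thus ?case using B by auto
  next
    case (Suc j)
    hence C: "B ^\<^sub>m j \<in> carrier_mat n n" and u: "upper_triangular (B ^\<^sub>m j)" by auto
    have e: "(B ^\<^sub>m Suc j) $$ (r, c) = (\<Sum>l<n. (B ^\<^sub>m j) $$ (r, l) * B $$ (l, c))" if "r < n" "c < n" for r c
      using mult_mat_entry[OF C B(1) that] by simp
    have z: "(B ^\<^sub>m j) $$ (r, l) * B $$ (l, c) = 0" if "r < n" "l < n" "l < r \<or> c < l" for r l c
      using that upper_triangularD[OF u, of l r] upper_triangularD[OF B(2), of c l] C B(1) by auto
    have "upper_triangular (B ^\<^sub>m Suc j)"
    proof
      fix r c assume "c < r" "r < dim_row (B ^\<^sub>m Suc j)"
      hence "r < n" "c < r" using C by auto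
      have "(B ^\<^sub>m Suc j) $$ (r, c) = (\<Sum>l<n. (B ^\<^sub>m j) $$ (r, l) * B $$ (l, c))"
        using \<open>r < n\<close> \<open>c < r\<close> by (intro e) auto
      also have "\<dots> = 0"
        using \<open>r < n\<close> \<open>c < r\<close> by (intro sum.neutral ballI z) auto
      finally show "(B ^\<^sub>m Suc j) $$ (r, c) = 0" .
    qed
    moreover have "(B ^\<^sub>m Suc j) $$ (i, i) = (B $$ (i, i)) ^ Suc j" if "i < n" for i
    proof -
      have "(B ^\<^sub>m Suc j) $$ (i, i) = (\<Sum>l<n. if l = i then (B ^\<^sub>m j) $$ (i, i) * B $$ (i, i) else 0)"
        unfolding e[OF that that]
      proof (rule sum.cong[OF refl])
        fix l assume "l \<in> {..<n}"
        thus "(B ^\<^sub>m j) $$ (i, l) * B $$ (l, i) = (if l = i then (B ^\<^sub>m j) $$ (i, i) * B $$ (i, i) else 0)"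
          using z[of i l i] that by (cases l i rule: linorder_cases) auto
      qed
      also have "\<dots> = (B ^\<^sub>m j) $$ (i, i) * B $$ (i, i)" using that by simp
      finally show ?thesis using Suc that by simp
    qed
    ultimately show ?case using C B by auto
  qed
  have root: "(B $$ (i, i)) ^ k = 1" if "i < n" for i
    using ut[of k] that Bk by (auto dest: spec[of _ i])
  have norm1: "cmod (B $$ (i, i)) = 1" if "i < n" for i
  proof -
    have "cmod (B $$ (i, i)) ^ k = 1 ^ k" using root[OF that] by (simp flip: norm_power)
    thus ?thesis by (rule power_eq_imp_eq_base) (use k(1) in auto)
  qed
  have re: "Re (B $$ (i, i)) \<le> 1" if "i < n" for i
    using complex_Re_le_cmod[of "B $$ (i, i)"] norm1[OF that] by simp
  \<comment> \<open>The summands are nonnegative, so their vanishing sum forces every real part to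
    be 1.\<close>
  have "(\<Sum>i<n. 1 - Re (B $$ (i, i))) = 0"
  proof -
    have "(\<Sum>i<n. B $$ (i, i)) = of_nat n" using trB B unfolding mtrace_def by auto
    hence "Re (\<Sum>i<n. B $$ (i, i)) = real n" by simp
    thus ?thesis by (simp add: sum_subtractf Re_sum)
  qed
  hence re1: "Re (B $$ (i, i)) = 1" if "i < n" for i
    using sum_nonneg_eq_0_iff[of "{..<n}" "\<lambda>i. 1 - Re (B $$ (i, i))"] re that by auto
  have diag1: "B $$ (i, i) = 1" if "i < n" for i
  proof -
    have "Im (B $$ (i, i)) = 0"
      using re1[OF that] norm1[OF that] by (simp add: cmod_def)
    thus ?thesis using re1[OF that] by (simp add: complex_eq_iff)
  qed
  \<comment> \<open>Entrywise form of the geometric sum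
    \<open>1 + B + ... + B ^ (m - 1)\<close>.\<close>
  define S where "S m = mat n n (\<lambda>ij. \<Sum>j<m. (B ^\<^sub>m j) $$ ij)" for m
  have Sc: "S m \<in> carrier_mat n n" for m unfolding S_def by auto
  have tele: "S m * (B - 1\<^sub>m n) = B ^\<^sub>m m - 1\<^sub>m n" for m
  proof (induct m)
    case 0
    have "S 0 = 0\<^sub>m n n" unfolding S_def by auto
    thus ?case using B by auto
  next
    case (Suc m)
    have C: "B ^\<^sub>m m \<in> carrier_mat n n" using ut by auto
    have D: "B - 1\<^sub>m n \<in> carrier_mat n n" by (rule minus_carrier_mat) simp
    have "S (Suc m) = S m + B ^\<^sub>m m" unfolding S_def using carrier_matD[OF B(1)]
      by (intro eq_matI) (auto split: if_splits)
    hence "S (Suc m) * (B - 1\<^sub>m n) = S m * (B - 1\<^sub>m n) + B ^\<^sub>m m * (B - 1\<^sub>m n)"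
      using add_mult_distrib_mat[OF Sc C D] by simp
    also have "B ^\<^sub>m m * (B - 1\<^sub>m n) = B ^\<^sub>m Suc m - B ^\<^sub>m m"
      using mult_minus_distrib_mat[OF C B(1) one_carrier_mat] right_mult_one_mat[OF C] by simp
    also have "S m * (B - 1\<^sub>m n) + (B ^\<^sub>m Suc m - B ^\<^sub>m m) = B ^\<^sub>m Suc m - 1\<^sub>m n"
      unfolding Suc using carrier_matD[OF C] carrier_matD[OF B(1)] by (intro eq_matI) auto
    finally show ?case .
  qed
  have "det (S k) \<noteq> 0"
  proof -
    have "upper_triangular (S k)"
    proof
      fix i j assume "j < i" "i < dim_row (S k)"
      thus "S k $$ (i, j) = 0"
        using ut upper_triangularD[of "B ^\<^sub>m _" j i] carrier_matD[OF B(1)] unfolding S_def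
        by (auto intro!: sum.neutral)
    qed
    moreover have "\<And>i. i < n \<Longrightarrow> S k $$ (i, i) = of_nat k"
      using ut diag1 unfolding S_def by auto
    ultimately show ?thesis
      using k(1) Sc[of k] upper_triangular_imp_det_eq_0_iff[OF Sc] by (auto simp: diag_mat_def)
  qed
  then obtain T where T: "T \<in> carrier_mat n n" "T * S k = 1\<^sub>m n" "S k * T = 1\<^sub>m n"
    using det_non_zero_imp_unit[OF Sc] unfolding Units_def ring_mat_simps by auto
  have D: "B - 1\<^sub>m n \<in> carrier_mat n n" by (rule minus_carrier_mat) simp
  have "S k * (B - 1\<^sub>m n) = 0\<^sub>m n n" using tele[of k] Bk by auto
  hence "T * (S k * (B - 1\<^sub>m n)) = 0\<^sub>m n n" using T by simp
  hence "B - 1\<^sub>m n = 0\<^sub>m n n"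
    using T(2) D assoc_mult_mat[OF T(1) Sc D, of k] by simp
  hence "B = 1\<^sub>m n"
    using B by (auto simp: mat_eq_iff)
  thus ?thesis using w by simp
qed

section \<open>Schur's lemma\<close>

lemma mat_eq_of_mult_vec:
  fixes A B :: "'a :: semiring_1 mat"
  assumes "A \<in> carrier_mat n m" "B \<in> carrier_mat n m"
    and eq: "\<And>v. v \<in> carrier_vec m \<Longrightarrow> A *\<^sub>v v = B *\<^sub>v v"
  shows "A = B"
proof (rule eq_matI)
  fix i j assume "i < dim_row B" "j < dim_col B"
  hence ij: "i < n" "j < m" using assms by auto
  have "M $$ (i, j) = (M *\<^sub>v unit_vec m j) $ i" if "M \<in> carrier_mat n m" for M :: "'a mat"
    using that ij by (auto simp: scalar_prod_right_unit)
  thus "A $$ (i, j) = B $$ (i, j)" using assms by (metis unit_vec_carrier)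
qed (use assms in auto)

lemma mult_mat_zero_vec [simp]:
  "A \<in> carrier_mat n m \<Longrightarrow> A *\<^sub>v 0\<^sub>v m = (0\<^sub>v n :: 'a :: semiring_0 vec)"
  by (intro eq_vecI) auto

lemma zero_mat_mult_vec [simp]:
  "v \<in> carrier_vec m \<Longrightarrow> 0\<^sub>m n m *\<^sub>v v = (0\<^sub>v n :: 'a :: semiring_0 vec)"
  by (intro eq_vecI) auto

text \<open>Trades the unit group \<open>GL n\<close> for matrix identities. Invertibility of
  \<open>\<rho> g\<close> is recovered from \<open>\<rho> (inv g)\<close>; the condition at
  \<open>\<one>\<close> is listed because a multiplicative map into matrices may send
  \<open>\<one>\<close> to a proper idempotent.\<close>

lemma is_representation_iff:
  fixes G (structure)
  assumes "group G"
  shows "is_representation G n \<rho> \<longleftrightarrow>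
    (\<forall>g\<in>carrier G. \<rho> g \<in> carrier_mat n n) \<and>
    (\<forall>g\<in>carrier G. \<forall>h\<in>carrier G. \<rho> (g \<otimes>\<^bsub>G\<^esub> h) = \<rho> g * \<rho> h) \<and> \<rho> \<one>\<^bsub>G\<^esub> = 1\<^sub>m n"
    (is "?L \<longleftrightarrow> ?R")
proof -
  interpret group G by fact
  note GLs = GL_def is_representation_def hom_def units_of_def Units_def ring_mat_simps
  show ?thesis
  proof
    assume L: ?L
    hence c: "\<rho> g \<in> carrier_mat n n" if "g \<in> carrier G" for g using that by (auto simp: GLs)
    moreover have m: "\<rho> (g \<otimes> h) = \<rho> g * \<rho> h" if "g \<in> carrier G" "h \<in> carrier G" for g h
      using L that by (auto simp: GLs)
    moreover have "\<rho> \<one> = 1\<^sub>m n"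
    proof -
      obtain x where x: "x \<in> carrier_mat n n" "x * \<rho> \<one> = 1\<^sub>m n"
        using L by (auto simp: GLs Pi_iff dest!: bspec[of _ _ \<one>])
      have c1: "\<rho> \<one> \<in> carrier_mat n n" and m1: "\<rho> \<one> * \<rho> \<one> = \<rho> \<one>"
        using c m[of \<one> \<one>] by auto
      have "\<rho> \<one> = x * \<rho> \<one> * \<rho> \<one>" using x c1 by (simp del: assoc_mult_mat)
      also have "\<dots> = x * \<rho> \<one>" using assoc_mult_mat[OF x(1) c1 c1] m1 by simp
      finally show ?thesis using x by simp
    qed
    ultimately show ?R by auto
  next
    assume R: ?R
    have "\<rho> g * \<rho> (inv g) = 1\<^sub>m n \<and> \<rho> (inv g) * \<rho> g = 1\<^sub>m n" if g: "g \<in> carrier G" for g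
    proof -
      have "\<rho> (g \<otimes> inv g) = \<rho> g * \<rho> (inv g)" "\<rho> (inv g \<otimes> g) = \<rho> (inv g) * \<rho> g"
        using R g inv_closed[OF g] by blast+
      moreover have "\<rho> \<one> = 1\<^sub>m n" using R by blast
      ultimately show ?thesis using r_inv[OF g] l_inv[OF g] by metis
    qed
    moreover have "\<rho> (inv g) \<in> carrier_mat n n" if "g \<in> carrier G" for g using R that by blast
    ultimately show ?L using R unfolding GLs by auto
  qed
qed

context group
begin

lemma repD:
  assumes "is_representation G n \<rho>"
  shows "g \<in> carrier G \<Longrightarrow> \<rho> g \<in> carrier_mat n n"
    and "g \<in> carrier G \<Longrightarrow> h \<in> carrier G \<Longrightarrow> \<rho> (g \<otimes> h) = \<rho> g * \<rho> h"
    and "\<rho> \<one> = 1\<^sub>m n"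
  using assms is_representation_iff[OF is_group] by auto

lemma irreducible_repD:
  assumes "is_irreducible_representation G n \<rho>"
  shows "is_representation G n \<rho>" "n > 0"
  using assms by (auto simp: is_irreducible_representation_def)

lemma invariant_subspace_cases:
  assumes "is_irreducible_representation G n \<rho>"
    and "W \<subseteq> carrier_vec n" "0\<^sub>v n \<in> W" "\<And>v w. v \<in> W \<Longrightarrow> w \<in> W \<Longrightarrow> v + w \<in> W"
    and "\<And>c v. v \<in> W \<Longrightarrow> c \<cdot>\<^sub>v v \<in> W" "\<And>g w. g \<in> carrier G \<Longrightarrow> w \<in> W \<Longrightarrow> \<rho> g *\<^sub>v w \<in> W"
  shows "W = {0\<^sub>v n} \<or> W = carrier_vec n"
  using assms by (auto simp: is_irreducible_representation_def subspace_module_vec_iff)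

text \<open>Kernel and image of an intertwiner are invariant, so a nonzero one is injective and
  surjective. As the two degrees may differ a priori, a two-sided inverse is delivered
  explicitly.\<close>

lemma schur_inverse:
  assumes \<rho>: "is_irreducible_representation G n \<rho>" and \<sigma>: "is_irreducible_representation G m \<sigma>"
    and Y: "Y \<in> carrier_mat n m" "Y \<noteq> 0\<^sub>m n m"
    and comm: "\<And>g. g \<in> carrier G \<Longrightarrow> \<rho> g * Y = Y * \<sigma> g"
  obtains Z where "Z \<in> carrier_mat m n" "Y * Z = 1\<^sub>m n" "Z * Y = 1\<^sub>m m"
proof -
  note r = repD[OF irreducible_repD(1)[OF \<rho>]] and s = repD[OF irreducible_repD(1)[OF \<sigma>]]
  have act: "\<rho> g *\<^sub>v (Y *\<^sub>v v) = Y *\<^sub>v (\<sigma> g *\<^sub>v v)" if "g \<in> carrier G" "v \<in> carrier_vec m" for g v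
    using comm[OF that(1)] that r(1)[OF that(1)] s(1)[OF that(1)] Y(1) by (metis assoc_mult_mat_vec)
  define K where "K = {v \<in> carrier_vec m. Y *\<^sub>v v = 0\<^sub>v n}"
  have "K = {0\<^sub>v m} \<or> K = carrier_vec m"
  proof (rule invariant_subspace_cases[OF \<sigma>])
    show "\<And>v w. v \<in> K \<Longrightarrow> w \<in> K \<Longrightarrow> v + w \<in> K"
      unfolding K_def using Y by (auto simp: mult_add_distrib_mat_vec)
    show "\<And>c v. v \<in> K \<Longrightarrow> c \<cdot>\<^sub>v v \<in> K"
      unfolding K_def using Y by (auto simp: mult_mat_vec)
    fix g w assume g: "g \<in> carrier G" and "w \<in> K"
    hence w: "w \<in> carrier_vec m" "Y *\<^sub>v w = 0\<^sub>v n" by (auto simp: K_def)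
    have "Y *\<^sub>v (\<sigma> g *\<^sub>v w) = 0\<^sub>v n" using act[OF g w(1)] w(2) r(1)[OF g] by simp
    thus "\<sigma> g *\<^sub>v w \<in> K" using s(1)[OF g] w by (simp add: K_def)
  qed (use Y in \<open>auto simp: K_def\<close>)
  moreover have "K \<noteq> carrier_vec m"
  proof
    assume "K = carrier_vec m"
    hence "Y *\<^sub>v v = 0\<^sub>m n m *\<^sub>v v" if "v \<in> carrier_vec m" for v
      using that by (auto simp: K_def set_eq_iff)
    hence "Y = 0\<^sub>m n m" using Y by (intro mat_eq_of_mult_vec[of _ n m]) auto
    thus False using Y by simp
  qed
  ultimately have K: "K = {0\<^sub>v m}" by auto
  define I where "I = (\<lambda>v. Y *\<^sub>v v) ` carrier_vec m"
  have "I = {0\<^sub>v n} \<or> I = carrier_vec n"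
  proof (rule invariant_subspace_cases[OF \<rho>])
    show "0\<^sub>v n \<in> I" unfolding I_def using Y by (intro image_eqI[of _ _ "0\<^sub>v m"]) auto
    show "v + w \<in> I" if "v \<in> I" "w \<in> I" for v w
      using that Y unfolding I_def by (auto simp flip: mult_add_distrib_mat_vec)
    show "c \<cdot>\<^sub>v v \<in> I" if "v \<in> I" for c v
      using that Y unfolding I_def by (auto simp flip: mult_mat_vec)
    show "\<rho> g *\<^sub>v w \<in> I" if "g \<in> carrier G" "w \<in> I" for g w
      using that act s(1)[OF that(1)] unfolding I_def by auto
  qed (use Y in \<open>auto simp: I_def\<close>)
  moreover have "I \<noteq> {0\<^sub>v n}"
  proof
    assume "I = {0\<^sub>v n}"
    hence "Y *\<^sub>v v = 0\<^sub>v n" if "v \<in> carrier_vec m" for v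
      using that unfolding I_def by blast
    hence "K = carrier_vec m" by (auto simp: K_def)
    thus False using \<open>K \<noteq> carrier_vec m\<close> by simp
  qed
  ultimately have "I = carrier_vec n" by auto
  hence "\<forall>j. \<exists>z. z \<in> carrier_vec m \<and> Y *\<^sub>v z = unit_vec n j"
    unfolding I_def by (metis (no_types, lifting) imageE unit_vec_carrier)
  then obtain z where z: "\<And>j. z j \<in> carrier_vec m" "\<And>j. Y *\<^sub>v z j = unit_vec n j" by metis
  \<comment> \<open>The columns are preimages of the unit vectors, which makes \<open>Z\<close> a
    right inverse.\<close>
  define Z where "Z = mat m n (\<lambda>(i, j). z j $ i)"
  have Z: "Z \<in> carrier_mat m n" by (simp add: Z_def)
  have colZ: "col Z j = z j" if "j < n" for j
    using that z(1)[of j] by (intro eq_vecI) (auto simp: Z_def)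
  have YZ: "Y * Z = 1\<^sub>m n"
  proof (rule eq_matI)
    fix i j assume "i < dim_row (1\<^sub>m n)" "j < dim_col (1\<^sub>m n)"
    hence ij: "i < n" "j < n" by auto
    have "(Y * Z) $$ (i, j) = (Y *\<^sub>v z j) $ i" using ij Y Z colZ by simp
    thus "(Y * Z) $$ (i, j) = 1\<^sub>m n $$ (i, j)" using ij z by (simp add: unit_vec_def)
  qed (use Y Z in auto)
  have "Z * Y = 1\<^sub>m m"
  proof (rule mat_eq_of_mult_vec[of _ m m])
    fix v :: "complex vec" assume v: "v \<in> carrier_vec m"
    have ZYv: "Z * Y *\<^sub>v v \<in> carrier_vec m" using Z Y v by auto
    \<comment> \<open>\<open>Z * Y\<close> fixes \<open>v\<close> up to an element of the kernel of
      \<open>Y\<close>, which is zero.\<close>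
    have "Y *\<^sub>v (Z * Y *\<^sub>v v) = Y * Z *\<^sub>v (Y *\<^sub>v v)"
      using Z Y v by (simp add: assoc_mult_mat_vec[of _ n m] assoc_mult_mat_vec[of _ m n])
    also have "\<dots> = Y *\<^sub>v v" using YZ Y v by simp
    finally have "Y *\<^sub>v (Z * Y *\<^sub>v v - v) = 0\<^sub>v n"
      using mult_minus_distrib_mat_vec[OF Y(1) ZYv v] Y v by simp
    hence "Z * Y *\<^sub>v v - v \<in> K" using v ZYv by (simp add: K_def)
    hence d: "Z * Y *\<^sub>v v - v = 0\<^sub>v m" using K by simp
    have "(Z * Y *\<^sub>v v) $ i = v $ i" if "i < m" for i
      using arg_cong[OF d, of "\<lambda>x. x $ i"] that v ZYv by simp
    thus "Z * Y *\<^sub>v v = 1\<^sub>m m *\<^sub>v v" using v ZYv Z by (intro eq_vecI) auto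
  qed (use Z Y in auto)
  with Z YZ show thesis by (rule that)
qed

text \<open>\<open>Y\<close> has a complex eigenvalue \<open>c\<close>; then \<open>Y - c\<close>
  still intertwines but kills an eigenvector, so it is not invertible and must vanish.\<close>

lemma schur_scalar:
  assumes \<rho>: "is_irreducible_representation G n \<rho>" and Y: "Y \<in> carrier_mat n n"
    and comm: "\<And>g. g \<in> carrier G \<Longrightarrow> \<rho> g * Y = Y * \<rho> g"
  obtains c where "Y = c \<cdot>\<^sub>m 1\<^sub>m n"
proof -
  note r = repD[OF irreducible_repD(1)[OF \<rho>]]
  obtain c where "eigenvalue Y c"
    using spectrum_non_empty[OF Y irreducible_repD(2)[OF \<rho>]] by (auto simp: spectrum_def)
  then obtain v where v: "v \<in> carrier_vec n" "v \<noteq> 0\<^sub>v n" "Y *\<^sub>v v = c \<cdot>\<^sub>v v"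
    using Y by (auto simp: eigenvalue_def eigenvector_def)
  define D where "D = Y - c \<cdot>\<^sub>m 1\<^sub>m n"
  have c1: "c \<cdot>\<^sub>m 1\<^sub>m n \<in> carrier_mat n n" by simp
  have D: "D \<in> carrier_mat n n" unfolding D_def by (rule minus_carrier_mat) simp
  have "D = 0\<^sub>m n n"
  proof (rule ccontr)
    assume nz: "D \<noteq> 0\<^sub>m n n"
    have "\<rho> g * D = D * \<rho> g" if "g \<in> carrier G" for g
      unfolding D_def using comm[OF that] r(1)[OF that] Y
        mult_minus_distrib_mat[OF r(1)[OF that] Y c1] minus_mult_distrib_mat[OF Y c1 r(1)[OF that]]
        mult_smult_distrib[OF r(1)[OF that] one_carrier_mat] mult_smult_assoc_mat[OF one_carrier_mat r(1)[OF that]]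
      by simp
    then obtain Z where Z: "Z \<in> carrier_mat n n" "Z * D = 1\<^sub>m n"
      using schur_inverse[OF \<rho> \<rho> D nz] by metis
    have "c \<cdot>\<^sub>m 1\<^sub>m n *\<^sub>v v = c \<cdot>\<^sub>v v" using v(1) by (intro eq_vecI) auto
    hence "D *\<^sub>v v = 0\<^sub>v n"
      unfolding D_def using v minus_mult_distrib_mat_vec[OF Y c1 v(1)] by simp
    moreover have "v = Z *\<^sub>v (D *\<^sub>v v)"
      using Z D v by (metis assoc_mult_mat_vec one_mult_mat_vec)
    ultimately show False using Z v by simp
  qed
  have "Y $$ (i, j) = (c \<cdot>\<^sub>m 1\<^sub>m n) $$ (i, j)" if "i < n" "j < n" for i j
    using arg_cong[OF \<open>D = 0\<^sub>m n n\<close>, of "\<lambda>M. M $$ (i, j)"] that Y by (simp add: D_def)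
  hence "Y = c \<cdot>\<^sub>m 1\<^sub>m n" using Y by (intro eq_matI) auto
  thus thesis by (rule that)
qed

end

section \<open>Orthogonality and decomposition of characters\<close>

context group
begin

lemma character_of_eq: "g \<in> carrier G \<Longrightarrow> character_of G \<rho> g = mtrace (\<rho> g)"
  by (simp add: character_of_def sum_list_diag_mat)

lemma IrrE:
  assumes "\<chi> \<in> Irr G"
  obtains n \<rho> where "is_irreducible_representation G n \<rho>" "\<chi> = character_of G \<rho>"
    "\<And>g. g \<in> carrier G \<Longrightarrow> \<chi> g = mtrace (\<rho> g)" "\<chi> \<one> = of_nat n"
proof -
  obtain n \<rho> where "is_irreducible_representation G n \<rho>" "\<chi> = character_of G \<rho>"
    using assms by (auto simp: Irr_def)
  moreover from this have "\<And>g. g \<in> carrier G \<Longrightarrow> \<chi> g = mtrace (\<rho> g)" "\<chi> \<one> = of_nat n"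
    using repD(3)[OF irreducible_repD(1), of n \<rho>] by (simp_all add: character_of_eq)
  ultimately show thesis by (rule that)
qed

lemma Irr_extensional: "\<chi> \<in> Irr G \<Longrightarrow> \<chi> \<in> extensional (carrier G)"
  by (auto simp: Irr_def character_of_def)

lemma character_of_in_Irr: "is_irreducible_representation G n \<rho> \<Longrightarrow> character_of G \<rho> \<in> Irr G"
  by (auto simp: Irr_def)

section \<open>Averaging over the group and Schur orthogonality\<close>

lemma sum_translate:
  fixes f :: "'a \<Rightarrow> 'c :: comm_monoid_add"
  assumes "h \<in> carrier G"
  shows "(\<Sum>g\<in>carrier G. f (h \<otimes> g)) = (\<Sum>g\<in>carrier G. f g)"
proof (rule sum.reindex_bij_witness[of _ "\<lambda>g. inv h \<otimes> g" "\<lambda>g. h \<otimes> g"])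
qed (use assms in \<open>auto simp: m_assoc[symmetric]\<close>)

text \<open>\<open>Y\<close> is the sum over the group of
  \<open>\<rho> g * E * \<sigma> (inv g)\<close>, where \<open>E\<close> is the elementary matrix
  with its 1 at \<open>(a, b)\<close>; translating the summation by \<open>h\<close> moves
  \<open>\<rho> h\<close> past it.\<close>

lemma coeff_sum_intertwines:
  assumes \<rho>: "is_representation G n \<rho>" and \<sigma>: "is_representation G m \<sigma>"
    and a: "a < n" and b: "b < m" and h: "h \<in> carrier G"
  defines "Y \<equiv> mat n m (\<lambda>(i, j). \<Sum>g\<in>carrier G. \<rho> g $$ (i, a) * \<sigma> (inv g) $$ (b, j))"
  shows "\<rho> h * Y = Y * \<sigma> h"
proof (rule eq_matI)
  note r = repD[OF \<rho>] and s = repD[OF \<sigma>]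
  have Y: "Y \<in> carrier_mat n m" by (simp add: Y_def)
  fix i j assume "i < dim_row (Y * \<sigma> h)" "j < dim_col (Y * \<sigma> h)"
  hence ij: "i < n" "j < m" using Y s(1)[OF h] by auto
  have "(\<rho> h * Y) $$ (i, j) = (\<Sum>l<n. \<rho> h $$ (i, l) * (\<Sum>g\<in>carrier G. \<rho> g $$ (l, a) * \<sigma> (inv g) $$ (b, j)))"
    using mult_mat_entry[OF r(1)[OF h] Y ij] ij by (simp add: Y_def)
  also have "\<dots> = (\<Sum>g\<in>carrier G. (\<Sum>l<n. \<rho> h $$ (i, l) * \<rho> g $$ (l, a)) * \<sigma> (inv g) $$ (b, j))"
    unfolding sum_distrib_left sum_distrib_right by (subst sum.swap) (simp add: mult.assoc)
  also have "\<dots> = (\<Sum>g\<in>carrier G. \<rho> (h \<otimes> g) $$ (i, a) * \<sigma> (inv g) $$ (b, j))"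
    using ij a h by (intro sum.cong refl) (simp add: r(2) mult_mat_entry[OF r(1) r(1)])
  \<comment> \<open>Writing \<open>inv g\<close> as \<open>inv (h \<otimes> g) \<otimes> h\<close>
    makes the summand a function of \<open>h \<otimes> g\<close>, ready for translation.\<close>
  also have "\<dots> = (\<Sum>g\<in>carrier G. \<rho> (h \<otimes> g) $$ (i, a) * \<sigma> (inv (h \<otimes> g) \<otimes> h) $$ (b, j))"
    using h by (intro sum.cong refl) (simp add: inv_mult_group m_assoc)
  also have "\<dots> = (\<Sum>g\<in>carrier G. \<rho> g $$ (i, a) * \<sigma> (inv g \<otimes> h) $$ (b, j))"
    by (rule sum_translate[OF h, of "\<lambda>g. \<rho> g $$ (i, a) * \<sigma> (inv g \<otimes> h) $$ (b, j)"])
  also have "\<dots> = (\<Sum>g\<in>carrier G. \<rho> g $$ (i, a) * (\<Sum>l<m. \<sigma> (inv g) $$ (b, l) * \<sigma> h $$ (l, j)))"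
    using ij b h by (intro sum.cong refl) (simp add: s(2) mult_mat_entry[OF s(1) s(1)])
  also have "\<dots> = (\<Sum>l<m. (\<Sum>g\<in>carrier G. \<rho> g $$ (i, a) * \<sigma> (inv g) $$ (b, l)) * \<sigma> h $$ (l, j))"
    unfolding sum_distrib_left sum_distrib_right by (subst sum.swap) (simp add: mult.assoc)
  also have "\<dots> = (Y * \<sigma> h) $$ (i, j)"
    using mult_mat_entry[OF Y s(1)[OF h] ij] ij by (simp add: Y_def)
  finally show "(\<rho> h * Y) $$ (i, j) = (Y * \<sigma> h) $$ (i, j)" .
qed (use repD(1)[OF \<rho> h] repD(1)[OF \<sigma> h] in \<open>auto simp: Y_def\<close>)

text \<open>The innermost sum is the entry \<open>(a, b)\<close> of the intertwiner averaged from
  position \<open>(a, b)\<close>, so Schur's lemma evaluates it.\<close>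

lemma trace_product_eq_coeff_sum:
  assumes \<rho>: "is_representation G n \<rho>" and \<sigma>: "is_representation G m \<sigma>"
  shows "(\<Sum>g\<in>carrier G. mtrace (\<rho> g) * mtrace (\<sigma> (inv g))) =
    (\<Sum>a<n. \<Sum>b<m. \<Sum>g\<in>carrier G. \<rho> g $$ (a, a) * \<sigma> (inv g) $$ (b, b))"
proof -
  have "(\<Sum>g\<in>carrier G. mtrace (\<rho> g) * mtrace (\<sigma> (inv g))) =
      (\<Sum>g\<in>carrier G. \<Sum>a<n. \<Sum>b<m. \<rho> g $$ (a, a) * \<sigma> (inv g) $$ (b, b))"
  proof (rule sum.cong[OF refl])
    fix g assume "g \<in> carrier G"
    hence "dim_row (\<rho> g) = n" "dim_row (\<sigma> (inv g)) = m"
      using repD(1)[OF \<rho>, of g] repD(1)[OF \<sigma>, of "inv g"] by auto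
    thus "mtrace (\<rho> g) * mtrace (\<sigma> (inv g)) = (\<Sum>a<n. \<Sum>b<m. \<rho> g $$ (a, a) * \<sigma> (inv g) $$ (b, b))"
      by (simp add: mtrace_def sum_product)
  qed
  also have "\<dots> = (\<Sum>a<n. \<Sum>g\<in>carrier G. \<Sum>b<m. \<rho> g $$ (a, a) * \<sigma> (inv g) $$ (b, b))"
    by (rule sum.swap)
  also have "\<dots> = (\<Sum>a<n. \<Sum>b<m. \<Sum>g\<in>carrier G. \<rho> g $$ (a, a) * \<sigma> (inv g) $$ (b, b))"
    by (intro sum.cong refl sum.swap)
  finally show ?thesis .
qed

text \<open>A nonzero averaged intertwiner would be invertible and conjugate one representation into
  the other, making the characters equal. Distinct characters replace inequivalence because
  \<open>Irr G\<close> consists of functions.\<close>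

lemma trace_orthogonal_inequivalent:
  assumes \<rho>: "is_irreducible_representation G n \<rho>" and \<sigma>: "is_irreducible_representation G m \<sigma>"
    and ne: "character_of G \<rho> \<noteq> character_of G \<sigma>"
  shows "(\<Sum>g\<in>carrier G. mtrace (\<rho> g) * mtrace (\<sigma> (inv g))) = 0"
proof -
  note r = irreducible_repD(1)[OF \<rho>] and s = irreducible_repD(1)[OF \<sigma>]
  have "(\<Sum>g\<in>carrier G. \<rho> g $$ (a, a) * \<sigma> (inv g) $$ (b, b)) = 0" if ab: "a < n" "b < m" for a b
  proof -
    define Y where "Y = mat n m (\<lambda>(i, j). \<Sum>g\<in>carrier G. \<rho> g $$ (i, a) * \<sigma> (inv g) $$ (b, j))"
    have Y: "Y \<in> carrier_mat n m" by (simp add: Y_def)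
    have comm: "\<rho> g * Y = Y * \<sigma> g" if "g \<in> carrier G" for g
      unfolding Y_def using coeff_sum_intertwines[OF r s ab that] .
    have "Y = 0\<^sub>m n m"
    proof (rule ccontr)
      assume "Y \<noteq> 0\<^sub>m n m"
      from schur_inverse[OF \<rho> \<sigma> Y this comm] obtain Z
        where Z: "Z \<in> carrier_mat m n" "Y * Z = 1\<^sub>m n" "Z * Y = 1\<^sub>m m" by metis
      have "mtrace (\<rho> g) = mtrace (\<sigma> g)" if g: "g \<in> carrier G" for g
      proof -
        have c: "\<rho> g \<in> carrier_mat n n" "\<sigma> g \<in> carrier_mat m m" using repD(1) r s g by auto
        have "mtrace (\<rho> g) = mtrace (Z * \<rho> g * Y)" using mtrace_conj[OF c(1) Y Z(1,2)] by simp
        also have "Z * \<rho> g * Y = Z * (\<rho> g * Y)" by (rule assoc_mult_mat[OF Z(1) c(1) Y])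
        also have "\<dots> = Z * Y * \<sigma> g" unfolding comm[OF g] by (rule assoc_mult_mat[OF Z(1) Y c(2), symmetric])
        finally show ?thesis using Z(3) c(2) by simp
      qed
      hence "character_of G \<rho> = character_of G \<sigma>"
        by (auto simp: character_of_def sum_list_diag_mat)
      thus False using ne by simp
    qed
    hence "Y $$ (a, b) = 0" using ab by simp
    thus ?thesis using ab by (simp add: Y_def)
  qed
  thus ?thesis unfolding trace_product_eq_coeff_sum[OF r s] by simp
qed

lemma trace_orthonormal:
  assumes \<rho>: "is_irreducible_representation G n \<rho>"
  shows "(\<Sum>g\<in>carrier G. mtrace (\<rho> g) * mtrace (\<rho> (inv g))) = of_nat (Coset.order G)"
proof -
  note r = irreducible_repD(1)[OF \<rho>]
  have n: "n > 0" by (rule irreducible_repD(2)[OF \<rho>])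
  have "(\<Sum>g\<in>carrier G. \<rho> g $$ (a, a) * \<rho> (inv g) $$ (b, b)) = (if a = b then of_nat (Coset.order G) / of_nat n else 0)"
    if ab: "a < n" "b < n" for a b
  proof -
    define Y where "Y = mat n n (\<lambda>(i, j). \<Sum>g\<in>carrier G. \<rho> g $$ (i, a) * \<rho> (inv g) $$ (b, j))"
    have Y: "Y \<in> carrier_mat n n" by (simp add: Y_def)
    have "\<rho> g * Y = Y * \<rho> g" if "g \<in> carrier G" for g
      unfolding Y_def using coeff_sum_intertwines[OF r r ab that] .
    from schur_scalar[OF \<rho> Y this] obtain c where c: "Y = c \<cdot>\<^sub>m 1\<^sub>m n" by metis
    \<comment> \<open>The scalar is found from the trace of \<open>Y\<close>, which collapses
      because \<open>\<rho> (inv g) * \<rho> g\<close> is the identity.\<close>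
    have "of_nat n * c = mtrace Y" unfolding c by (subst mtrace_smult[of _ n]) auto
    also have "\<dots> = (\<Sum>i<n. \<Sum>g\<in>carrier G. \<rho> (inv g) $$ (b, i) * \<rho> g $$ (i, a))"
      by (simp add: mtrace_def Y_def mult.commute)
    also have "\<dots> = (\<Sum>g\<in>carrier G. \<Sum>i<n. \<rho> (inv g) $$ (b, i) * \<rho> g $$ (i, a))"
      by (rule sum.swap)
    also have "\<dots> = (\<Sum>g\<in>carrier G. 1\<^sub>m n $$ (b, a))"
    proof (rule sum.cong[OF refl])
      fix g assume g: "g \<in> carrier G"
      have "(\<Sum>i<n. \<rho> (inv g) $$ (b, i) * \<rho> g $$ (i, a)) = (\<rho> (inv g) * \<rho> g) $$ (b, a)"
        using mult_mat_entry[OF repD(1)[OF r inv_closed[OF g]] repD(1)[OF r g] ab(2,1)] by simp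
      also have "\<rho> (inv g) * \<rho> g = \<rho> (inv g \<otimes> g)"
        using repD(2)[OF r inv_closed[OF g] g] by simp
      finally show "(\<Sum>i<n. \<rho> (inv g) $$ (b, i) * \<rho> g $$ (i, a)) = 1\<^sub>m n $$ (b, a)"
        using g repD(3)[OF r] by simp
    qed
    also have "\<dots> = (if a = b then of_nat (Coset.order G) else 0)" using ab by (simp add: Coset.order_def)
    finally have "c = (if a = b then of_nat (Coset.order G) / of_nat n else 0)"
      using n by (auto simp: field_simps)
    moreover have "Y $$ (a, b) = (if a = b then c else 0)" unfolding c using ab by simp
    ultimately show ?thesis using ab by (simp add: Y_def split: if_splits)
  qed
  thus ?thesis unfolding trace_product_eq_coeff_sum[OF r r] using n by simp
qed

lemma Irr_orthogonality:
  assumes "\<chi> \<in> Irr G" "\<psi> \<in> Irr G"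
  shows "(\<Sum>g\<in>carrier G. \<chi> g * \<psi> (inv g)) = (if \<chi> = \<psi> then of_nat (Coset.order G) else 0)"
proof -
  obtain n \<rho> where r: "is_irreducible_representation G n \<rho>" "\<chi> = character_of G \<rho>"
    using assms IrrE by metis
  obtain m \<sigma> where s: "is_irreducible_representation G m \<sigma>" "\<psi> = character_of G \<sigma>"
    using assms IrrE by metis
  show ?thesis
  proof (cases "\<chi> = \<psi>")
    case True
    have "(\<Sum>g\<in>carrier G. \<chi> g * \<psi> (inv g)) = (\<Sum>g\<in>carrier G. mtrace (\<rho> g) * mtrace (\<rho> (inv g)))"
      using r True by (intro sum.cong refl) (simp add: character_of_eq)
    thus ?thesis using trace_orthonormal[OF r(1)] True by simp
  next
    case False
    have "(\<Sum>g\<in>carrier G. \<chi> g * \<psi> (inv g)) = (\<Sum>g\<in>carrier G. mtrace (\<rho> g) * mtrace (\<sigma> (inv g)))"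
      using r s by (intro sum.cong refl) (simp add: character_of_eq)
    thus ?thesis using trace_orthogonal_inequivalent[OF r(1) s(1)] r s False by simp
  qed
qed

text \<open>An invariant subspace makes all \<open>\<rho> g\<close> simultaneously block triangular,
  and the trace is the sum of the traces of the diagonal blocks.\<close>
lemma character_decomposition:
  assumes "is_representation G n \<rho>"
  shows "\<exists>cs. set cs \<subseteq> Irr G \<and> (\<forall>g\<in>carrier G. mtrace (\<rho> g) = (\<Sum>\<chi>\<leftarrow>cs. \<chi> g))"
  using assms
proof (induction n arbitrary: \<rho> rule: less_induct)
  case (less n)
  note r = repD[OF less.prems]
  consider "n = 0" | "is_irreducible_representation G n \<rho>" | "n > 0" "\<not> is_irreducible_representation G n \<rho>"
    by auto
  thus ?case
  proof cases
    case 1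
    thus ?thesis using carrier_matD(1)[OF r(1)] by (intro exI[of _ "[]"]) (auto simp: mtrace_def)
  next
    case 2
    thus ?thesis by (intro exI[of _ "[character_of G \<rho>]"]) (use 2 in \<open>auto simp: character_of_eq character_of_in_Irr\<close>)
  next
    case 3
    then obtain W where W: "subspace class_ring W (module_vec TYPE(complex) n)"
      and inv: "\<And>g w. g \<in> carrier G \<Longrightarrow> w \<in> W \<Longrightarrow> \<rho> g *\<^sub>v w \<in> W"
      and ne: "W \<noteq> {0\<^sub>v n}" "W \<noteq> carrier_vec n"
      using less.prems by (auto simp: is_irreducible_representation_def)
    obtain k P Q where k: "0 < k" "k < n" and P: "P \<in> carrier_mat n n" and Q: "Q \<in> carrier_mat n n"
      and PQ: "P * Q = 1\<^sub>m n" and QP: "Q * P = 1\<^sub>m n" and col: "\<And>j. j < k \<Longrightarrow> col P j \<in> W"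
      and van: "\<And>w i. w \<in> W \<Longrightarrow> k \<le> i \<Longrightarrow> i < n \<Longrightarrow> (Q *\<^sub>v w) $ i = 0"
      using adapted_basis[OF W ne] by metis
    define M where "M g = Q * \<rho> g * P" for g
    have M: "M g \<in> carrier_mat n n" if "g \<in> carrier G" for g
      unfolding M_def using P Q r(1)[OF that] by auto
    have Mmult: "M (g \<otimes> h) = M g * M h" if g: "g \<in> carrier G" and h: "h \<in> carrier G" for g h
    proof -
      have c: "\<rho> h * P \<in> carrier_mat n n" "\<rho> g * (\<rho> h * P) \<in> carrier_mat n n" "Q * (\<rho> h * P) \<in> carrier_mat n n"
        using r(1)[OF g] r(1)[OF h] P Q by auto
      have "M g * M h = Q * (\<rho> g * (P * (Q * (\<rho> h * P))))"
        unfolding M_def using r(1)[OF g] r(1)[OF h] P Q c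
        by (simp add: assoc_mult_mat[of _ n n _ n _ n])
      also have "P * (Q * (\<rho> h * P)) = P * Q * (\<rho> h * P)"
        by (rule assoc_mult_mat[OF P Q c(1), symmetric])
      also have "\<dots> = \<rho> h * P" using PQ left_mult_one_mat[OF c(1)] by simp
      also have "Q * (\<rho> g * (\<rho> h * P)) = M (g \<otimes> h)"
        unfolding M_def r(2)[OF g h] using r(1)[OF g] r(1)[OF h] P Q c
        by (simp add: assoc_mult_mat[of _ n n _ n _ n])
      finally show ?thesis by simp
    qed
    have Mone: "M \<one> = 1\<^sub>m n" unfolding M_def r(3) using P Q QP by simp
    \<comment> \<open>Column \<open>j\<close> of \<open>P\<close> lies in \<open>W\<close>, so does
      its image under \<open>\<rho> g\<close>, and \<open>Q\<close> gives elements of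
      \<open>W\<close> no coordinates beyond the first \<open>k\<close>.\<close>
    have Mzero: "M g $$ (i, j) = 0" if g: "g \<in> carrier G" and i: "k \<le> i" "i < n" and j: "j < k" for g i j
    proof -
      have "M g = Q * (\<rho> g * P)" unfolding M_def by (rule assoc_mult_mat[OF Q r(1)[OF g] P])
      moreover have "(Q * (\<rho> g * P)) $$ (i, j) = (Q *\<^sub>v col (\<rho> g * P) j) $ i"
        using i j k P Q r(1)[OF g] by simp
      moreover have "col (\<rho> g * P) j = \<rho> g *\<^sub>v col P j"
        using j k P r(1)[OF g] by (intro eq_vecI) auto
      ultimately show ?thesis using van[OF inv[OF g col[OF j]] i] by simp
    qed
    have split: "(\<Sum>l<n. f l) = (\<Sum>l<k. f l) + (\<Sum>l<n-k. f (l + k))" for f :: "nat \<Rightarrow> complex"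
    proof -
      have "(\<Sum>l<n. f l) = (\<Sum>l=0..<k. f l) + (\<Sum>l=k..<n. f l)"
        using sum.atLeastLessThan_concat[of 0 k n f] k by (simp add: atLeast0LessThan)
      also have "(\<Sum>l=k..<n. f l) = (\<Sum>l=0..<n-k. f (l + k))"
        using sum.shift_bounds_nat_ivl[of f 0 k "n - k"] k by simp
      finally show ?thesis by (simp add: atLeast0LessThan)
    qed
    \<comment> \<open>The diagonal blocks: \<open>\<sigma>\<close> is the action on
      \<open>W\<close>, \<open>\<tau>\<close> the action on the quotient space by \<open>W\<close>.
      The zero block makes both multiplicative.\<close>
    define \<sigma> where "\<sigma> g = mat k k (\<lambda>ij. M g $$ ij)" for g
    define \<tau> where "\<tau> g = mat (n - k) (n - k) (\<lambda>(i, j). M g $$ (i + k, j + k))" for g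
    have "is_representation G k \<sigma>"
      unfolding is_representation_iff[OF is_group]
    proof (intro conjI ballI)
      show "\<sigma> \<one> = 1\<^sub>m k" unfolding \<sigma>_def Mone using k by (intro eq_matI) auto
      fix g h assume g: "g \<in> carrier G" and h: "h \<in> carrier G"
      show "\<sigma> (g \<otimes> h) = \<sigma> g * \<sigma> h"
      proof (rule eq_matI)
        fix i j assume "i < dim_row (\<sigma> g * \<sigma> h)" "j < dim_col (\<sigma> g * \<sigma> h)"
        hence ij: "i < k" "j < k" by (auto simp: \<sigma>_def)
        have "\<sigma> (g \<otimes> h) $$ (i, j) = (\<Sum>l<n. M g $$ (i, l) * M h $$ (l, j))"
          using ij k Mmult[OF g h] mult_mat_entry[OF M[OF g] M[OF h], of i j] by (simp add: \<sigma>_def)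
        also have "\<dots> = (\<Sum>l<k. M g $$ (i, l) * M h $$ (l, j))"
          unfolding split using ij Mzero[OF h] by simp
        also have "\<dots> = (\<sigma> g * \<sigma> h) $$ (i, j)"
          using ij mult_mat_entry[of "\<sigma> g" k k "\<sigma> h" k i j] by (simp add: \<sigma>_def)
        finally show "\<sigma> (g \<otimes> h) $$ (i, j) = (\<sigma> g * \<sigma> h) $$ (i, j)" .
      qed (simp_all add: \<sigma>_def)
    qed (simp add: \<sigma>_def)
    moreover have "is_representation G (n - k) \<tau>"
      unfolding is_representation_iff[OF is_group]
    proof (intro conjI ballI)
      show "\<tau> \<one> = 1\<^sub>m (n - k)" unfolding \<tau>_def Mone using k by (intro eq_matI) auto
      fix g h assume g: "g \<in> carrier G" and h: "h \<in> carrier G"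
      show "\<tau> (g \<otimes> h) = \<tau> g * \<tau> h"
      proof (rule eq_matI)
        fix i j assume "i < dim_row (\<tau> g * \<tau> h)" "j < dim_col (\<tau> g * \<tau> h)"
        hence ij: "i < n - k" "j < n - k" by (auto simp: \<tau>_def)
        have "\<tau> (g \<otimes> h) $$ (i, j) = (\<Sum>l<n. M g $$ (i + k, l) * M h $$ (l, j + k))"
          using ij k Mmult[OF g h] mult_mat_entry[OF M[OF g] M[OF h], of "i + k" "j + k"] by (simp add: \<tau>_def)
        also have "\<dots> = (\<Sum>l<n-k. M g $$ (i + k, l + k) * M h $$ (l + k, j + k))"
          unfolding split using ij Mzero[OF g] by simp
        also have "\<dots> = (\<tau> g * \<tau> h) $$ (i, j)"
          using ij mult_mat_entry[of "\<tau> g" "n - k" "n - k" "\<tau> h" "n - k" i j] by (simp add: \<tau>_def)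
        finally show "\<tau> (g \<otimes> h) $$ (i, j) = (\<tau> g * \<tau> h) $$ (i, j)" .
      qed (simp_all add: \<tau>_def)
    qed (simp add: \<tau>_def)
    ultimately obtain cs ds where cs: "set cs \<subseteq> Irr G" "\<forall>g\<in>carrier G. mtrace (\<sigma> g) = (\<Sum>\<chi>\<leftarrow>cs. \<chi> g)"
      and ds: "set ds \<subseteq> Irr G" "\<forall>g\<in>carrier G. mtrace (\<tau> g) = (\<Sum>\<chi>\<leftarrow>ds. \<chi> g)"
      using less.IH[of k \<sigma>] less.IH[of "n - k" \<tau>] k by auto
    have "mtrace (\<rho> g) = mtrace (\<sigma> g) + mtrace (\<tau> g)" if g: "g \<in> carrier G" for g
    proof -
      have "mtrace (\<rho> g) = mtrace (M g)" unfolding M_def using mtrace_conj[OF r(1)[OF g] P Q PQ] by simp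
      also have "\<dots> = (\<Sum>l<n. M g $$ (l, l))" using M[OF g] by (simp add: mtrace_def)
      finally show ?thesis unfolding split by (simp add: mtrace_def \<sigma>_def \<tau>_def)
    qed
    thus ?thesis using cs ds by (intro exI[of _ "cs @ ds"]) auto
  qed
qed

end

section \<open>Characters of quotients\<close>

context group
begin

text \<open>Left multiplication as permutation matrices: the trace counts the fixed points of a
  translation, which are all elements or none. The enumeration \<open>e\<close> supplies numbers as
  matrix indices.\<close>

lemma regular_representation:
  assumes fin: "finite (carrier G)"
  shows "\<exists>\<rho>. is_representation G (Coset.order G) \<rho> \<and>
    (\<forall>g\<in>carrier G. mtrace (\<rho> g) = (if g = \<one> then of_nat (Coset.order G) else 0))"
proof -
  define n where "n = Coset.order G"
  obtain e where e: "bij_betw e {..<n} (carrier G)"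
    using ex_bij_betw_nat_finite[OF fin] by (auto simp: n_def Coset.order_def atLeast0LessThan)
  have eG: "e i \<in> carrier G" if "i < n" for i using e that by (auto simp: bij_betw_def)
  have inj: "e i = e j \<longleftrightarrow> i = j" if "i < n" "j < n" for i j
    using e that by (auto simp: bij_betw_def inj_on_def)
  have surj: "\<exists>i<n. e i = g" if "g \<in> carrier G" for g
    using e that by (metis bij_betw_imp_surj_on imageE lessThan_iff)
  define \<rho> where "\<rho> g = mat n n (\<lambda>(i, j). if e i = g \<otimes> e j then 1 else (0 :: complex))" for g
  have "is_representation G n \<rho>"
    unfolding is_representation_iff[OF is_group]
  proof (intro conjI ballI)
    show "\<rho> \<one> = 1\<^sub>m n" unfolding \<rho>_def by (intro eq_matI) (auto simp: eG inj)
    fix g h assume g: "g \<in> carrier G" and h: "h \<in> carrier G"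
    show "\<rho> (g \<otimes> h) = \<rho> g * \<rho> h"
    proof (rule eq_matI)
      fix i j assume "i < dim_row (\<rho> g * \<rho> h)" "j < dim_col (\<rho> g * \<rho> h)"
      hence ij: "i < n" "j < n" by (auto simp: \<rho>_def)
      obtain l where l: "l < n" "e l = h \<otimes> e j" using surj[of "h \<otimes> e j"] h eG[OF ij(2)] by auto
      have "(\<rho> g * \<rho> h) $$ (i, j) = (\<Sum>a<n. \<rho> g $$ (i, a) * \<rho> h $$ (a, j))"
        using ij by (intro mult_mat_entry[of _ n n _ n]) (auto simp: \<rho>_def)
      also have "\<dots> = (\<Sum>a<n. if a = l then \<rho> g $$ (i, l) else 0)"
        using ij l inj by (intro sum.cong refl) (auto simp: \<rho>_def simp flip: l(2))
      also have "\<dots> = \<rho> g $$ (i, l)" using l by simp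
      also have "\<dots> = \<rho> (g \<otimes> h) $$ (i, j)" using ij l g h eG by (simp add: \<rho>_def m_assoc)
      finally show "\<rho> (g \<otimes> h) $$ (i, j) = (\<rho> g * \<rho> h) $$ (i, j)" by simp
    qed (simp_all add: \<rho>_def)
  qed (simp add: \<rho>_def)
  moreover have "mtrace (\<rho> g) = (if g = \<one> then of_nat n else 0)" if g: "g \<in> carrier G" for g
  proof -
    have "mtrace (\<rho> g) = (\<Sum>i<n. if e i = g \<otimes> e i then 1 else 0)" by (simp add: mtrace_def \<rho>_def)
    also have "\<dots> = (\<Sum>i<n. if g = \<one> then 1 else 0)"
      using eG g by (intro sum.cong refl) (auto simp: r_cancel_one')
    finally show ?thesis by simp
  qed
  ultimately show ?thesis unfolding n_def by blast
qed

text \<open>Pulling the regular representation of the quotient back to \<open>G\<close> lets the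
  characters of the quotient be treated as members of \<open>Irr G\<close> with \<open>N\<close> in
  their kernel.\<close>

lemma quotient_regular_representation:
  assumes fin: "finite (carrier G)" and N: "N \<lhd> G"
  shows "\<exists>\<rho>. is_representation G (card (rcosets N)) \<rho> \<and>
    (\<forall>g\<in>carrier G. mtrace (\<rho> g) = (if g \<in> N then of_nat (card (rcosets N)) else 0))"
proof -
  interpret N: normal N G by fact
  interpret Q: group "G Mod N" by (rule N.factorgroup_is_group)
  have carQ: "carrier (G Mod N) = rcosets N" by (simp add: FactGroup_def)
  have "finite (carrier (G Mod N))" using fin by (simp add: FactGroup_def RCOSETS_def)
  from Q.regular_representation[OF this] obtain \<sigma> where s: "is_representation (G Mod N) (card (rcosets N)) \<sigma>"
    and t: "\<And>q. q \<in> rcosets N \<Longrightarrow> mtrace (\<sigma> q) = (if q = N then of_nat (card (rcosets N)) else 0)"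
    by (auto simp: carQ Coset.order_def)
  have "is_representation G (card (rcosets N)) (\<lambda>g. \<sigma> (N #> g))"
    using s N.r_coset_hom_Mod by (auto simp: is_representation_def hom_def Pi_iff)
  moreover have "N #> g = N \<longleftrightarrow> g \<in> N" if "g \<in> carrier G" for g
    using that rcos_self[OF that N.subgroup_axioms] coset_join2[OF that N.subgroup_axioms] by auto
  hence "mtrace (\<sigma> (N #> g)) = (if g \<in> N then of_nat (card (rcosets N)) else 0)" if "g \<in> carrier G" for g
    using t[OF rcosetsI[OF N.subset that]] that by simp
  ultimately show ?thesis by blast
qed

text \<open>The sum of \<open>\<rho>\<close> over \<open>N\<close> is a scalar \<open>c\<close> by Schur's lemma, and it absorbs \<open>\<rho> k\<close> for \<open>k \<in> N\<close>;
  comparing traces gives \<open>c \<chi>(k) = c \<chi>(1)\<close>.\<close>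
lemma Irr_sum_over_normal:
  assumes fin: "finite (carrier G)" and N: "N \<lhd> G" and \<chi>: "\<chi> \<in> Irr G"
  shows "(\<Sum>h\<in>N. \<chi> h) = (if N \<subseteq> char_ker G \<chi> then of_nat (card N) * \<chi> \<one> else 0)"
proof (cases "N \<subseteq> char_ker G \<chi>")
  case True
  hence "(\<Sum>h\<in>N. \<chi> h) = (\<Sum>h\<in>N. \<chi> \<one>)" by (intro sum.cong) (auto simp: char_ker_def)
  thus ?thesis using True by simp
next
  case False
  interpret N: normal N G by fact
  obtain n \<rho> where \<rho>: "is_irreducible_representation G n \<rho>"
    and \<chi>\<rho>: "\<And>g. g \<in> carrier G \<Longrightarrow> \<chi> g = mtrace (\<rho> g)" and deg: "\<chi> \<one> = of_nat n"
    using IrrE[OF \<chi>] by metis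
  note r = repD[OF irreducible_repD(1)[OF \<rho>]]
  obtain k where k: "k \<in> N" "\<chi> k \<noteq> \<chi> \<one>" using False by (auto simp: char_ker_def)
  have NG: "h \<in> carrier G" if "h \<in> N" for h using that N.subset by auto
  define Y where "Y = mat n n (\<lambda>ij. \<Sum>h\<in>N. \<rho> h $$ ij)"
  have Y: "Y \<in> carrier_mat n n" by (simp add: Y_def)
  have left: "(\<rho> g * Y) $$ (i, j) = (\<Sum>h\<in>N. \<rho> (g \<otimes> h) $$ (i, j))"
    if g: "g \<in> carrier G" and ij: "i < n" "j < n" for g i j
  proof -
    have "(\<rho> g * Y) $$ (i, j) = (\<Sum>l<n. \<Sum>h\<in>N. \<rho> g $$ (i, l) * \<rho> h $$ (l, j))"
      using mult_mat_entry[OF r(1)[OF g] Y ij] ij by (simp add: Y_def sum_distrib_left)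
    also have "\<dots> = (\<Sum>h\<in>N. \<Sum>l<n. \<rho> g $$ (i, l) * \<rho> h $$ (l, j))" by (rule sum.swap)
    also have "\<dots> = (\<Sum>h\<in>N. \<rho> (g \<otimes> h) $$ (i, j))"
      using ij g NG by (intro sum.cong refl) (simp add: r(2) mult_mat_entry[OF r(1) r(1)])
    finally show ?thesis .
  qed
  have right: "(Y * \<rho> g) $$ (i, j) = (\<Sum>h\<in>N. \<rho> (h \<otimes> g) $$ (i, j))"
    if g: "g \<in> carrier G" and ij: "i < n" "j < n" for g i j
  proof -
    have "(Y * \<rho> g) $$ (i, j) = (\<Sum>l<n. \<Sum>h\<in>N. \<rho> h $$ (i, l) * \<rho> g $$ (l, j))"
      using mult_mat_entry[OF Y r(1)[OF g] ij] ij by (simp add: Y_def sum_distrib_right)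
    also have "\<dots> = (\<Sum>h\<in>N. \<Sum>l<n. \<rho> h $$ (i, l) * \<rho> g $$ (l, j))" by (rule sum.swap)
    also have "\<dots> = (\<Sum>h\<in>N. \<rho> (h \<otimes> g) $$ (i, j))"
      using ij g NG by (intro sum.cong refl) (simp add: r(2) mult_mat_entry[OF r(1) r(1)])
    finally show ?thesis .
  qed
  have "\<rho> g * Y = Y * \<rho> g" if g: "g \<in> carrier G" for g
  proof (rule eq_matI)
    fix i j assume "i < dim_row (Y * \<rho> g)" "j < dim_col (Y * \<rho> g)"
    hence ij: "i < n" "j < n" using Y r(1)[OF g] by auto
    \<comment> \<open>Conjugation by \<open>g\<close> permutes the normal subgroup \<open>N\<close>;
      this is why the sum over \<open>N\<close> commutes with every \<open>\<rho> g\<close>.\<close>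
    have "(\<Sum>h\<in>N. \<rho> (g \<otimes> h) $$ (i, j)) = (\<Sum>h\<in>N. \<rho> (h \<otimes> g) $$ (i, j))"
    proof (rule sum.reindex_bij_witness[of _ "\<lambda>h. inv g \<otimes> h \<otimes> g" "\<lambda>h. g \<otimes> h \<otimes> inv g"])
      fix h assume h: "h \<in> N"
      note hG = NG[OF h]
      show "g \<otimes> h \<otimes> inv g \<in> N" "inv g \<otimes> h \<otimes> g \<in> N"
        using N.inv_op_closed1[OF g h] N.inv_op_closed2[OF g h] by auto
      show "inv g \<otimes> (g \<otimes> h \<otimes> inv g) \<otimes> g = h" "g \<otimes> (inv g \<otimes> h \<otimes> g) \<otimes> inv g = h"
        using g hG inv_solve_left[of "inv g" _ h] by (simp_all add: m_assoc) (simp_all add: m_assoc[symmetric])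
      show "\<rho> (g \<otimes> h \<otimes> inv g \<otimes> g) $$ (i, j) = \<rho> (g \<otimes> h) $$ (i, j)"
        using g hG by (simp add: m_assoc)
    qed
    thus "(\<rho> g * Y) $$ (i, j) = (Y * \<rho> g) $$ (i, j)" using left[OF g ij] right[OF g ij] by simp
  qed (use Y r(1)[OF g] in auto)
  from schur_scalar[OF \<rho> Y this] obtain c where c: "Y = c \<cdot>\<^sub>m 1\<^sub>m n" by metis
  have kG: "k \<in> carrier G" using k NG by auto
  have "\<rho> k * Y = Y"
  proof (rule eq_matI)
    fix i j assume "i < dim_row Y" "j < dim_col Y"
    hence ij: "i < n" "j < n" using Y by auto
    have "(\<Sum>h\<in>N. \<rho> (k \<otimes> h) $$ (i, j)) = (\<Sum>h\<in>N. \<rho> h $$ (i, j))"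
      by (rule sum.reindex_bij_witness[of _ "\<lambda>h. inv k \<otimes> h" "\<lambda>h. k \<otimes> h"])
        (use k(1) NG in \<open>auto simp: m_assoc[symmetric]\<close>)
    thus "(\<rho> k * Y) $$ (i, j) = Y $$ (i, j)" using left[OF kG ij] ij by (simp add: Y_def)
  qed (use Y r(1)[OF kG] in auto)
  moreover have "\<rho> k * Y = c \<cdot>\<^sub>m \<rho> k"
    unfolding c using mult_smult_distrib[OF r(1)[OF kG] one_carrier_mat] r(1)[OF kG] by simp
  ultimately have "mtrace (c \<cdot>\<^sub>m \<rho> k) = mtrace (c \<cdot>\<^sub>m 1\<^sub>m n)" using c by simp
  hence "c * \<chi> k = c * \<chi> \<one>"
    using mtrace_smult[OF r(1)[OF kG]] mtrace_smult[of "1\<^sub>m n" n c] \<chi>\<rho>[OF kG] deg by simp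
  hence "c = 0" using k by simp
  have "(\<Sum>h\<in>N. \<chi> h) = (\<Sum>h\<in>N. \<Sum>i<n. \<rho> h $$ (i, i))"
    using \<chi>\<rho> NG carrier_matD(1)[OF r(1)] by (intro sum.cong refl) (simp add: mtrace_def)
  also have "\<dots> = (\<Sum>i<n. \<Sum>h\<in>N. \<rho> h $$ (i, i))" by (rule sum.swap)
  also have "\<dots> = mtrace Y" by (simp add: mtrace_def Y_def)
  also have "\<dots> = 0" unfolding c \<open>c = 0\<close> by (simp add: mtrace_def)
  finally show ?thesis using False by simp
qed

section \<open>The regular character of a quotient and its constituents\<close>

lemma multiplicity_in_decomposition:
  assumes "set cs \<subseteq> Irr G" "\<psi> \<in> Irr G"
  shows "(\<Sum>g\<in>carrier G. (\<Sum>\<chi>\<leftarrow>cs. \<chi> g) * \<psi> (inv g)) = of_nat (count_list cs \<psi>) * of_nat (Coset.order G)"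
  using assms
proof (induction cs)
  case (Cons \<chi> cs)
  thus ?case using Irr_orthogonality[of \<chi> \<psi>] by (auto simp: ring_distribs sum.distrib)
qed simp

lemma Irr_one_nonzero: "\<chi> \<in> Irr G \<Longrightarrow> \<chi> \<one> \<noteq> 0"
  using irreducible_repD(2) by (fastforce elim: IrrE)

text \<open>By orthogonality the multiplicity of \<open>\<psi>\<close> times the order of
  \<open>G\<close> is the index of \<open>N\<close> times the sum of \<open>\<psi>\<close> over
  \<open>N\<close>, and that sum is \<open>card N * \<psi> \<one>\<close> or 0 according to whether
  \<open>N\<close> lies in the kernel. Multiplicities are kept as repetitions in the list.\<close>

lemma quotient_regular_decomposition:
  assumes fin: "finite (carrier G)" and N: "N \<lhd> G"
  shows "\<exists>cs. set cs = {\<chi> \<in> Irr G. N \<subseteq> char_ker G \<chi>} \<and>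
    (\<forall>\<chi>\<in>set cs. of_nat (count_list cs \<chi>) = \<chi> \<one>) \<and>
    (\<forall>g\<in>carrier G. (\<Sum>\<chi>\<leftarrow>cs. \<chi> g) = (if g \<in> N then of_nat (card (rcosets N)) else 0))"
proof -
  interpret N: normal N G by fact
  obtain \<rho> where \<rho>: "is_representation G (card (rcosets N)) \<rho>"
    and tr: "\<And>g. g \<in> carrier G \<Longrightarrow> mtrace (\<rho> g) = (if g \<in> N then of_nat (card (rcosets N)) else 0)"
    using quotient_regular_representation[OF assms] by auto
  obtain cs where cs: "set cs \<subseteq> Irr G" "\<And>g. g \<in> carrier G \<Longrightarrow> mtrace (\<rho> g) = (\<Sum>\<chi>\<leftarrow>cs. \<chi> g)"
    using character_decomposition[OF \<rho>] by auto
  have ord: "of_nat (card (rcosets N)) * of_nat (card N) = (of_nat (Coset.order G) :: complex)"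
    using lagrange[OF N.subgroup_axioms] by (simp flip: of_nat_mult)
  have "Coset.order G > 0" using fin by (simp add: order_gt_0_iff_finite)
  have mult: "of_nat (count_list cs \<psi>) = (if N \<subseteq> char_ker G \<psi> then \<psi> \<one> else 0)" if \<psi>: "\<psi> \<in> Irr G" for \<psi>
  proof -
    have "of_nat (count_list cs \<psi>) * of_nat (Coset.order G) = (\<Sum>g\<in>carrier G. mtrace (\<rho> g) * \<psi> (inv g))"
      unfolding multiplicity_in_decomposition[OF cs(1) \<psi>, symmetric] using cs(2) by simp
    also have "\<dots> = (\<Sum>g\<in>N. of_nat (card (rcosets N)) * \<psi> (inv g))"
      using fin N.subset by (intro sum.mono_neutral_cong_right) (auto simp: tr)
    also have "\<dots> = of_nat (card (rcosets N)) * (\<Sum>g\<in>N. \<psi> (inv g))"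
      by (simp add: sum_distrib_left)
    also have "(\<Sum>g\<in>N. \<psi> (inv g)) = (\<Sum>g\<in>N. \<psi> g)"
      by (rule sum.reindex_bij_witness[of _ "\<lambda>g. inv g" "\<lambda>g. inv g"]) (use N.subset in auto)
    also have "of_nat (card (rcosets N)) * \<dots> = (if N \<subseteq> char_ker G \<psi> then \<psi> \<one> else 0) * of_nat (Coset.order G)"
      unfolding Irr_sum_over_normal[OF fin N \<psi>] ord[symmetric] by simp
    finally show ?thesis using \<open>Coset.order G > 0\<close> by simp
  qed
  have "\<psi> \<in> set cs \<longleftrightarrow> \<psi> \<in> Irr G \<and> N \<subseteq> char_ker G \<psi>" for \<psi>
  proof (cases "\<psi> \<in> Irr G")
    case True
    thus ?thesis using mult[OF True] Irr_one_nonzero[OF True] count_list_0_iff[of cs \<psi>]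
      by (cases "N \<subseteq> char_ker G \<psi>") auto
  qed (use cs(1) in auto)
  hence "set cs = {\<chi> \<in> Irr G. N \<subseteq> char_ker G \<chi>}" by auto
  moreover have "(\<Sum>\<chi>\<leftarrow>cs. \<chi> g) = (if g \<in> N then of_nat (card (rcosets N)) else 0)" if gG: "g \<in> carrier G" for g
    using tr[OF gG] cs(2)[OF gG] by simp
  moreover have "of_nat (count_list cs \<chi>) = \<chi> \<one>" if "\<chi> \<in> set cs" for \<chi>
    using mult[of \<chi>] that calculation(1) by simp
  ultimately show ?thesis by blast
qed

text \<open>Every irreducible character is a constituent of the regular character, hence a member of
  one list.\<close>

lemma finite_Irr:
  assumes "finite (carrier G)"
  shows "finite (Irr G)"
proof -
  obtain cs where "set cs = {\<chi> \<in> Irr G. {\<one>} \<subseteq> char_ker G \<chi>}"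
    using quotient_regular_decomposition[OF assms one_is_normal] by blast
  hence "set cs = Irr G" by (auto simp: char_ker_def)
  thus ?thesis by (metis finite_set)
qed

text \<open>At \<open>g = \<one>\<close> this is a sum of squares of degrees; with \<open>N\<close>
  trivial it also tells \<open>\<one>\<close> apart from all other elements.\<close>

lemma sum_degree_times_Irr:
  assumes "finite (carrier G)" "N \<lhd> G" "g \<in> carrier G"
  shows "(\<Sum>\<chi> | \<chi> \<in> Irr G \<and> N \<subseteq> char_ker G \<chi>. \<chi> \<one> * \<chi> g) = (if g \<in> N then of_nat (card (rcosets N)) else 0)"
proof -
  obtain cs where cs: "set cs = {\<chi> \<in> Irr G. N \<subseteq> char_ker G \<chi>}"
    "\<And>\<chi>. \<chi> \<in> set cs \<Longrightarrow> of_nat (count_list cs \<chi>) = \<chi> \<one>"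
    "\<And>g. g \<in> carrier G \<Longrightarrow> (\<Sum>\<chi>\<leftarrow>cs. \<chi> g) = (if g \<in> N then of_nat (card (rcosets N)) else 0)"
    using quotient_regular_decomposition[OF assms(1,2)] by blast
  have "(\<Sum>\<chi>\<leftarrow>cs. \<chi> g) = (\<Sum>\<chi>\<in>set cs. of_nat (count_list cs \<chi>) * \<chi> g)"
  proof (induction cs)
    case (Cons \<psi> cs)
    have "(\<Sum>\<chi>\<in>set (\<psi> # cs). of_nat (count_list (\<psi> # cs) \<chi>) * \<chi> g)
        = (\<Sum>\<chi>\<in>set (\<psi> # cs). (if \<chi> = \<psi> then \<psi> g else 0) + of_nat (count_list cs \<chi>) * \<chi> g)"
      by (intro sum.cong refl) (auto simp: ring_distribs)
    also have "\<dots> = \<psi> g + (\<Sum>\<chi>\<in>set (\<psi> # cs). of_nat (count_list cs \<chi>) * \<chi> g)"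
      by (subst sum.distrib) (simp add: sum.delta)
    also have "(\<Sum>\<chi>\<in>set (\<psi> # cs). of_nat (count_list cs \<chi>) * \<chi> g) = (\<Sum>\<chi>\<in>set cs. of_nat (count_list cs \<chi>) * \<chi> g)"
      by (rule sum.mono_neutral_right) (auto simp: count_list_0_iff)
    finally show ?case using Cons by simp
  qed simp
  also have "\<dots> = (\<Sum>\<chi>\<in>set cs. \<chi> \<one> * \<chi> g)" using cs(2) by (intro sum.cong) auto
  finally show ?thesis using cs assms(3) by simp
qed

end

section \<open>Kernels and degrees\<close>

lemma card_image_eq_if_same_fibres:
  assumes "\<And>x y. x \<in> C \<Longrightarrow> y \<in> C \<Longrightarrow> f x = f y \<longleftrightarrow> g x = g y"
  shows "card (f ` C) = card (g ` C)"
proof (rule bij_betw_same_card[of "\<lambda>z. g (inv_into C f z)"])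
  have inv: "inv_into C f (f x) \<in> C" "f (inv_into C f (f x)) = f x" if "x \<in> C" for x
    using that by (auto intro: inv_into_into f_inv_into_f)
  hence g: "g (inv_into C f (f x)) = g x" if "x \<in> C" for x using assms that by metis
  show "bij_betw (\<lambda>z. g (inv_into C f z)) (f ` C) (g ` C)"
    unfolding bij_betw_def inj_on_def by (auto simp: g assms image_image)
qed

lemma even_card_if_fixpoint_free_involution:
  assumes "finite S" "\<And>x. x \<in> S \<Longrightarrow> f x \<in> S" "\<And>x. x \<in> S \<Longrightarrow> f (f x) = x" "\<And>x. x \<in> S \<Longrightarrow> f x \<noteq> x"
  shows "even (card S)"
  using assms
proof (induction S rule: finite_psubset_induct)
  case (psubset S)
  show ?case
  proof (cases "S = {}")
    case False
    then obtain x where x: "x \<in> S" by auto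
    define T where "T = S - {x, f x}"
    have "f y \<in> T" if "y \<in> T" for y
      using that psubset.prems(1,2) x by (auto simp: T_def) metis+
    moreover have "T \<subset> S" using x by (auto simp: T_def)
    ultimately have "even (card T)"
      using psubset.IH[of T] psubset.prems by (auto simp: T_def)
    moreover have "card S = card T + 2"
    proof -
      have "S = insert x (insert (f x) T)" using x psubset.prems(1) by (auto simp: T_def)
      moreover have "finite T" "x \<notin> insert (f x) T" "f x \<notin> T"
        using psubset.hyps psubset.prems(3)[OF x] by (auto simp: T_def)
      ultimately show ?thesis by simp
    qed
    ultimately show ?thesis by simp
  qed simp
qed

text \<open>Reads the degree off \<open>\<chi>\<close> as a natural number, without choosing a
  representation; the rounding is exact on \<open>Irr G\<close>.\<close>

definition char_degree :: "('a, 'm) monoid_scheme \<Rightarrow> ('a \<Rightarrow> complex) \<Rightarrow> nat" where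
  "char_degree G \<chi> = nat \<lfloor>Re (\<chi> \<one>\<^bsub>G\<^esub>)\<rfloor>"

context group
begin

text \<open>The fibres of \<open>f\<close> are the right cosets of \<open>N\<close>. Any function is
  allowed as \<open>f\<close>, so that a linear character can be used directly.\<close>

lemma card_rcosets_eq_card_image:
  assumes N: "subgroup N G"
    and f: "\<And>x y. x \<in> carrier G \<Longrightarrow> y \<in> carrier G \<Longrightarrow> f x = f y \<longleftrightarrow> x \<otimes> inv y \<in> N"
  shows "card (rcosets N) = card (f ` carrier G)"
proof -
  have "N #> x = N #> y \<longleftrightarrow> f x = f y" if x: "x \<in> carrier G" and y: "y \<in> carrier G" for x y
    using subgroup.rcos_module[OF N is_group y x] repr_independence[of x N y] rcos_self[OF x N] f[OF x y] N x y
    by auto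
  hence "card ((\<lambda>x. N #> x) ` carrier G) = card (f ` carrier G)"
    by (rule card_image_eq_if_same_fibres)
  moreover have "rcosets N = (\<lambda>x. N #> x) ` carrier G" by (auto simp: RCOSETS_def)
  ultimately show ?thesis by simp
qed

text \<open>The map \<open>h\<close> has kernel \<open>N \<inter> K\<close>, so the quotient embeds
  in the product of the other two and Lagrange applies. Indices prime to \<open>q\<close> are
  thereby stable under intersection.\<close>

lemma index_Int_dvd:
  assumes N: "N \<lhd> G" and K: "K \<lhd> G"
  shows "card (rcosets (N \<inter> K)) dvd card (rcosets N) * card (rcosets K)"
proof -
  interpret N: normal N G by fact
  interpret K: normal K G by fact
  define H where "H = (G Mod N) \<times>\<times> (G Mod K)"
  define h where "h x = (N #> x, K #> x)" for x
  have gH: "group H" unfolding H_def by (intro DirProd_group N.factorgroup_is_group K.factorgroup_is_group)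
  have "h \<in> hom G H"
    using N.r_coset_hom_Mod K.r_coset_hom_Mod by (auto simp: H_def h_def hom_def DirProd_def Pi_iff)
  then interpret h: group_hom G H h using gH by (simp add: group_hom_def group_hom_axioms_def)
  have "N #> x = N #> y \<longleftrightarrow> x \<otimes> inv y \<in> N" "K #> x = K #> y \<longleftrightarrow> x \<otimes> inv y \<in> K"
    if x: "x \<in> carrier G" and y: "y \<in> carrier G" for x y
    using N.rcos_module[OF is_group y x] repr_independence[of x N y] rcos_self[OF x N.subgroup_axioms]
      K.rcos_module[OF is_group y x] repr_independence[of x K y] rcos_self[OF x K.subgroup_axioms]
      N.subgroup_axioms K.subgroup_axioms x y by auto
  hence "card (rcosets (N \<inter> K)) = card (h ` carrier G)"
    using subgroups_Inter_pair[OF N.subgroup_axioms K.subgroup_axioms]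
    by (intro card_rcosets_eq_card_image) (auto simp: h_def)
  also have "\<dots> dvd Coset.order H"
    using group.lagrange[OF gH h.img_is_subgroup] by (metis dvd_triv_right)
  also have "Coset.order H = card (rcosets N) * card (rcosets K)"
    by (simp add: H_def Coset.order_def DirProd_def FactGroup_def card_cartesian_product)
  finally show ?thesis .
qed

lemma Irr_one_eq_char_degree:
  assumes "\<chi> \<in> Irr G"
  shows "\<chi> \<one> = of_nat (char_degree G \<chi>)" "char_degree G \<chi> > 0"
proof -
  obtain n \<rho> where \<rho>: "is_irreducible_representation G n \<rho>" "\<chi> \<one> = of_nat n"
    using IrrE[OF assms] by metis
  moreover have "n > 0" by (rule irreducible_repD(2)[OF \<rho>(1)])
  ultimately show "\<chi> \<one> = of_nat (char_degree G \<chi>)" "char_degree G \<chi> > 0"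
    by (simp_all add: char_degree_def)
qed

lemma IrrE':
  assumes "\<chi> \<in> Irr G"
  obtains \<rho> where "is_irreducible_representation G (char_degree G \<chi>) \<rho>" "\<chi> = character_of G \<rho>"
    "\<And>g. g \<in> carrier G \<Longrightarrow> \<chi> g = mtrace (\<rho> g)"
proof -
  obtain n \<rho> where "is_irreducible_representation G n \<rho>" "\<chi> = character_of G \<rho>"
    "\<And>g. g \<in> carrier G \<Longrightarrow> \<chi> g = mtrace (\<rho> g)" "\<chi> \<one> = of_nat n"
    using IrrE[OF assms] by metis
  moreover from this(4) have "char_degree G \<chi> = n"
    using Irr_one_eq_char_degree(1)[OF assms] by simp
  ultimately show thesis using that by simp
qed

lemma rep_pow:
  assumes "is_representation G n \<rho>" "g \<in> carrier G"
  shows "\<rho> (g [^] (k :: nat)) = \<rho> g ^\<^sub>m k"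
  by (induction k) (use repD[OF assms(1)] assms(2) carrier_matD(1)[OF repD(1)[OF assms]] in auto)

text \<open>Each \<open>\<rho> g\<close> has finite order, and a matrix of finite order has trace
  equal to its size only if it is the identity. So the set defined by character values is the kernel
  of a homomorphism.\<close>

lemma char_ker_character_of:
  assumes fin: "finite (carrier G)" and \<rho>: "is_representation G n \<rho>"
  shows "char_ker G (character_of G \<rho>) = {g \<in> carrier G. \<rho> g = 1\<^sub>m n}"
proof -
  have "\<rho> g = 1\<^sub>m n" if g: "g \<in> carrier G" and eq: "mtrace (\<rho> g) = of_nat n" for g
  proof (rule finite_order_mtrace_eq_dim[OF repD(1)[OF \<rho> g] _ _ eq])
    show "Coset.order G > 0" using fin by (simp add: order_gt_0_iff_finite)
    show "\<rho> g ^\<^sub>m Coset.order G = 1\<^sub>m n"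
      using rep_pow[OF \<rho> g, of "Coset.order G"] pow_order_eq_1[OF g] repD(3)[OF \<rho>] by simp
  qed
  hence "mtrace (\<rho> g) = of_nat n \<longleftrightarrow> \<rho> g = 1\<^sub>m n" if "g \<in> carrier G" for g
    using that mtrace_one by metis
  thus ?thesis using repD(3)[OF \<rho>] by (auto simp: char_ker_def character_of_eq)
qed

lemma char_ker_normal:
  assumes fin: "finite (carrier G)" and \<chi>: "\<chi> \<in> Irr G"
  shows "char_ker G \<chi> \<lhd> G"
proof -
  obtain \<rho> where \<rho>: "is_irreducible_representation G (char_degree G \<chi>) \<rho>" "\<chi> = character_of G \<rho>"
    using IrrE'[OF \<chi>] by metis
  define n where "n = char_degree G \<chi>"
  have rep: "is_representation G n \<rho>" using irreducible_repD(1)[OF \<rho>(1)] by (simp add: n_def)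
  note r = repD[OF rep]
  have ker: "char_ker G \<chi> = {g \<in> carrier G. \<rho> g = 1\<^sub>m n}"
    unfolding \<rho>(2) by (rule char_ker_character_of[OF fin rep])
  have inv: "\<rho> (inv g) * \<rho> g = 1\<^sub>m n" "\<rho> g * \<rho> (inv g) = 1\<^sub>m n" if "g \<in> carrier G" for g
    using r(2)[OF inv_closed[OF that] that] r(2)[OF that inv_closed[OF that]] r(3) that by simp_all
  have "subgroup (char_ker G \<chi>) G"
  proof (rule subgroupI)
    show "inv g \<in> char_ker G \<chi>" if "g \<in> char_ker G \<chi>" for g
      using that inv[of g] r(1)[of "inv g"] by (auto simp: ker)
    show "char_ker G \<chi> \<noteq> {}" using r(3) by (auto simp: ker)
  qed (auto simp: ker r(2))
  moreover have "g \<otimes> h \<otimes> inv g \<in> char_ker G \<chi>" if g: "g \<in> carrier G" and h: "h \<in> char_ker G \<chi>" for g h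
    using g h inv(2)[OF g] r(1)[OF g] by (auto simp: ker r(2))
  ultimately show ?thesis unfolding normal_inv_iff by auto
qed

lemma cod_times_char_degree:
  assumes "\<chi> \<in> Irr G"
  shows "cod G \<chi> * of_nat (char_degree G \<chi>) = of_nat (card (rcosets (char_ker G \<chi>)))"
  using Irr_one_eq_char_degree[OF assms] by (simp add: cod_def)

lemma sum_char_degree_squares:
  assumes fin: "finite (carrier G)" and N: "N \<lhd> G"
  shows "(\<Sum>\<chi> | \<chi> \<in> Irr G \<and> N \<subseteq> char_ker G \<chi>. (char_degree G \<chi>)\<^sup>2) = card (rcosets N)"
proof -
  interpret N: normal N G by fact
  have "of_nat (\<Sum>\<chi> | \<chi> \<in> Irr G \<and> N \<subseteq> char_ker G \<chi>. (char_degree G \<chi>)\<^sup>2)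
      = (\<Sum>\<chi> | \<chi> \<in> Irr G \<and> N \<subseteq> char_ker G \<chi>. \<chi> \<one> * \<chi> \<one>)"
    using Irr_one_eq_char_degree(1) by (simp add: power2_eq_square)
  also have "\<dots> = of_nat (card (rcosets N))"
    using sum_degree_times_Irr[OF fin N one_closed] by simp
  finally show ?thesis by (simp only: of_nat_eq_iff)
qed

lemma order_eq_sum_char_degree_squares:
  assumes fin: "finite (carrier G)"
  shows "(\<Sum>\<chi>\<in>Irr G. (char_degree G \<chi>)\<^sup>2) = Coset.order G"
proof -
  have "{\<chi>. \<chi> \<in> Irr G \<and> {\<one>} \<subseteq> char_ker G \<chi>} = Irr G" by (auto simp: char_ker_def)
  moreover have "card (rcosets {\<one>}) = Coset.order G"
    using lagrange[OF triv_subgroup] by simp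
  ultimately show ?thesis using sum_char_degree_squares[OF fin one_is_normal] by simp
qed

lemma trivial_character:
  defines "\<epsilon> \<equiv> (\<lambda>g\<in>carrier G. 1 :: complex)"
  shows "\<epsilon> \<in> Irr G" "char_degree G \<epsilon> = 1" "char_ker G \<epsilon> = carrier G"
proof -
  have "is_irreducible_representation G 1 (\<lambda>g. 1\<^sub>m 1)"
    unfolding is_irreducible_representation_def is_representation_iff[OF is_group] subspace_module_vec_iff
  proof (intro conjI allI impI)
    fix W :: "complex vec set"
    assume W: "W \<subseteq> carrier_vec 1 \<and> 0\<^sub>v 1 \<in> W \<and> (\<forall>v\<in>W. \<forall>w\<in>W. v + w \<in> W) \<and> (\<forall>c. \<forall>v\<in>W. c \<cdot>\<^sub>v v \<in> W)"
    show "W = {0\<^sub>v 1} \<or> W = carrier_vec 1"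
    proof (rule disjCI)
      assume "W \<noteq> carrier_vec 1"
      then obtain u where u: "u \<in> carrier_vec 1" "u \<notin> W" using W by auto
      have "w = 0\<^sub>v 1" if w: "w \<in> W" for w
      proof (rule ccontr)
        assume "w \<noteq> 0\<^sub>v 1"
        hence "w $ 0 \<noteq> 0" using w W by (auto simp: vec_eq_iff)
        hence "u = (u $ 0 / w $ 0) \<cdot>\<^sub>v w" using w W u by (intro eq_vecI) auto
        thus False using u W w by metis
      qed
      thus "W = {0\<^sub>v 1}" using W by auto
    qed
  qed auto
  hence "character_of G (\<lambda>g. 1\<^sub>m 1) \<in> Irr G" by (rule character_of_in_Irr)
  moreover have "character_of G (\<lambda>g. 1\<^sub>m 1) = \<epsilon>" by (simp add: character_of_def sum_list_diag_mat \<epsilon>_def)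
  ultimately show "\<epsilon> \<in> Irr G" by simp
qed (auto simp: \<epsilon>_def char_degree_def char_ker_def)

text \<open>In the sum of squares for the quotient by the kernel, both \<open>\<chi>\<close> and the
  trivial character occur; the latter makes the inequality strict.\<close>

lemma char_degree_square_less:
  assumes fin: "finite (carrier G)" and \<chi>: "\<chi> \<in> Irr G" "\<chi> \<noteq> (\<lambda>g\<in>carrier G. 1)"
  shows "(char_degree G \<chi>)\<^sup>2 < card (rcosets (char_ker G \<chi>))"
proof -
  define \<epsilon> :: "'a \<Rightarrow> complex" where "\<epsilon> = (\<lambda>g\<in>carrier G. 1)"
  note t = trivial_character[folded \<epsilon>_def]
  have "(char_degree G \<chi>)\<^sup>2 < (\<Sum>\<psi>\<in>{\<chi>, \<epsilon>}. (char_degree G \<psi>)\<^sup>2)"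
    using \<chi> t by (simp add: \<epsilon>_def)
  also have "\<dots> \<le> (\<Sum>\<psi> | \<psi> \<in> Irr G \<and> char_ker G \<chi> \<subseteq> char_ker G \<psi>. (char_degree G \<psi>)\<^sup>2)"
    using \<chi> t finite_Irr[OF fin] by (intro sum_mono2) (auto simp: char_ker_def)
  also have "\<dots> = card (rcosets (char_ker G \<chi>))"
    by (rule sum_char_degree_squares[OF fin char_ker_normal[OF fin \<chi>(1)]])
  finally show ?thesis .
qed

text \<open>Linear characters are 1 on a commutator \<open>c\<close>, so the sum of all
  \<open>\<chi> \<one> * \<chi> c\<close> is the number of characters, which is positive; but the
  regular character vanishes away from \<open>\<one>\<close>.\<close>

lemma comm_group_if_linear:
  assumes fin: "finite (carrier G)" and lin: "\<And>\<chi>. \<chi> \<in> Irr G \<Longrightarrow> char_degree G \<chi> = 1"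
  shows "comm_group G"
proof (rule group_comm_groupI)
  fix a b assume a: "a \<in> carrier G" and b: "b \<in> carrier G"
  define c where "c = a \<otimes> b \<otimes> inv (b \<otimes> a)"
  have c: "c \<in> carrier G" using a b by (simp add: c_def)
  have "\<chi> \<one> * \<chi> c = 1" if \<chi>: "\<chi> \<in> Irr G" for \<chi>
  proof -
    obtain \<rho> where \<rho>: "is_irreducible_representation G 1 \<rho>" "\<And>g. g \<in> carrier G \<Longrightarrow> \<chi> g = mtrace (\<rho> g)"
      using IrrE'[OF \<chi>] lin[OF \<chi>] by metis
    note r = repD[OF irreducible_repD(1)[OF \<rho>(1)]]
    have "\<rho> a * \<rho> b = \<rho> b * \<rho> a"
      using r(1)[OF a] r(1)[OF b] by (intro eq_matI) (auto simp: scalar_prod_def)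
    hence "\<rho> (a \<otimes> b) = \<rho> (b \<otimes> a)" using a b r(2) by simp
    hence "\<rho> c = \<rho> (b \<otimes> a \<otimes> inv (b \<otimes> a))"
      unfolding c_def using a b r(2)[of "a \<otimes> b" "inv (b \<otimes> a)"] r(2)[of "b \<otimes> a" "inv (b \<otimes> a)"] by simp
    also have "\<dots> = 1\<^sub>m 1" using a b r(3) r_inv[of "b \<otimes> a"] by simp
    finally show ?thesis
      using \<rho>(2)[OF c] Irr_one_eq_char_degree(1)[OF \<chi>] lin[OF \<chi>] by simp
  qed
  hence "(\<Sum>\<chi>\<in>Irr G. \<chi> \<one> * \<chi> c) = (\<Sum>\<chi>\<in>Irr G. 1)"
    by (intro sum.cong refl)
  hence "of_nat (card (Irr G)) = (\<Sum>\<chi>\<in>Irr G. \<chi> \<one> * \<chi> c)" by simp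
  also have "Irr G = {\<chi>. \<chi> \<in> Irr G \<and> {\<one>} \<subseteq> char_ker G \<chi>}" by (auto simp: char_ker_def)
  also note sum_degree_times_Irr[OF fin one_is_normal c]
  finally have "of_nat (card (Irr G)) = (if c = \<one> then of_nat (card (rcosets {\<one>})) else (0 :: complex))"
    by (simp add: char_ker_def)
  moreover have "card (Irr G) \<noteq> 0"
    using trivial_character(1) finite_Irr[OF fin] by auto
  ultimately have "c = \<one>" by (auto split: if_splits)
  moreover have "a \<otimes> b = c \<otimes> (b \<otimes> a)" using a b by (simp add: c_def inv_solve_right m_assoc)
  ultimately show "a \<otimes> b = b \<otimes> a" using a b by simp
qed

end

section \<open>Codegrees and real characters of odd p-groups\<close>

context group
begin

text \<open>The subgroups of index prime to \<open>q\<close> among the normal ones are closed under intersection, so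
  the one \<open>N\<close> of least order is contained in all of them.\<close>
lemma not_prime_dvd_order:
  assumes fin: "finite (carrier G)" and q: "Factorial_Ring.prime (q :: nat)"
    and cod: "\<And>\<chi>. \<chi> \<in> Irr G \<Longrightarrow>
      \<exists>c. card (rcosets (char_ker G \<chi>)) = char_degree G \<chi> * c \<and> \<not> q dvd c"
  shows "\<not> q dvd Coset.order G"
proof -
  define P where "P K \<longleftrightarrow> K \<lhd> G \<and> \<not> q dvd card (rcosets K)" for K
  have "card (rcosets (carrier G)) * Coset.order G = Coset.order G"
    using lagrange[OF subgroup_self] by (simp add: Coset.order_def)
  moreover have "Coset.order G > 0" using fin by (simp add: order_gt_0_iff_finite)
  ultimately have "card (rcosets (carrier G)) = 1" by simp
  moreover have "carrier G \<lhd> G" by (rule normal_invI[OF subgroup_self]) auto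
  ultimately have "P (carrier G)" using not_prime_unit[of q] q by (auto simp: P_def)
  then obtain N where N: "P N" and min: "\<And>K. P K \<Longrightarrow> card N \<le> card K"
    using ex_has_least_nat[of P "carrier G" card] by blast
  have NG: "N \<lhd> G" using N by (simp add: P_def)
  have fN: "finite N" using fin normal_imp_subgroup[OF NG] subgroup.subset finite_subset by metis
  have least: "N \<subseteq> K" if K: "P K" for K
  proof -
    have KG: "K \<lhd> G" using K by (simp add: P_def)
    have "card (rcosets (N \<inter> K)) dvd card (rcosets N) * card (rcosets K)"
      by (rule index_Int_dvd[OF NG KG])
    moreover have "\<not> q dvd card (rcosets N) * card (rcosets K)"
      using N K q by (simp add: P_def prime_dvd_mult_iff)
    ultimately have "P (N \<inter> K)"
      using normal_subgroup_intersect[OF NG KG] by (auto simp: P_def dest: dvd_trans)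
    hence "N \<inter> K = N" using min fN by (intro card_seteq) auto
    thus ?thesis by auto
  qed
  have "q dvd (char_degree G \<chi>)\<^sup>2" if \<chi>: "\<chi> \<in> Irr G" "\<not> N \<subseteq> char_ker G \<chi>" for \<chi>
  proof -
    \<comment> \<open>By the choice of \<open>N\<close>, a kernel not containing it has index
      divisible by \<open>q\<close>. The codegree is prime to \<open>q\<close>, so the factor sits
      in the degree.\<close>
    have "q dvd card (rcosets (char_ker G \<chi>))"
      using least[of "char_ker G \<chi>"] char_ker_normal[OF fin \<chi>(1)] \<chi>(2) by (auto simp: P_def)
    hence "q dvd char_degree G \<chi>"
      using cod[OF \<chi>(1)] q by (auto simp: prime_dvd_mult_iff)
    thus ?thesis by (simp add: power2_eq_square)
  qed
  hence "q dvd (\<Sum>\<chi> | \<chi> \<in> Irr G \<and> \<not> N \<subseteq> char_ker G \<chi>. (char_degree G \<chi>)\<^sup>2)"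
    by (intro dvd_sum) auto
  moreover have "Coset.order G = card (rcosets N) + (\<Sum>\<chi> | \<chi> \<in> Irr G \<and> \<not> N \<subseteq> char_ker G \<chi>. (char_degree G \<chi>)\<^sup>2)"
  proof -
    have "Irr G = {\<chi>. \<chi> \<in> Irr G \<and> N \<subseteq> char_ker G \<chi>} \<union> {\<chi>. \<chi> \<in> Irr G \<and> \<not> N \<subseteq> char_ker G \<chi>}" by auto
    hence "Coset.order G = (\<Sum>\<chi>\<in>{\<chi>. \<chi> \<in> Irr G \<and> N \<subseteq> char_ker G \<chi>} \<union> {\<chi>. \<chi> \<in> Irr G \<and> \<not> N \<subseteq> char_ker G \<chi>}. (char_degree G \<chi>)\<^sup>2)"
      using order_eq_sum_char_degree_squares[OF fin] by metis
    also have "\<dots> = (\<Sum>\<chi> | \<chi> \<in> Irr G \<and> N \<subseteq> char_ker G \<chi>. (char_degree G \<chi>)\<^sup>2) + (\<Sum>\<chi> | \<chi> \<in> Irr G \<and> \<not> N \<subseteq> char_ker G \<chi>. (char_degree G \<chi>)\<^sup>2)"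
      using finite_Irr[OF fin] by (intro sum.union_disjoint) auto
    finally show ?thesis using sum_char_degree_squares[OF fin NG] by simp
  qed
  ultimately show ?thesis using N by (simp add: P_def dvd_add_left_iff)
qed

text \<open>Class equation: the conjugation orbit \<open>{\<one>}\<close> contributes 1 to a total
  divisible by \<open>p\<close>, so another orbit has size prime to \<open>p\<close>; this size is a
  power of \<open>p\<close>, hence 1.\<close>

lemma nontrivial_center_p_group:
  assumes p: "Factorial_Ring.prime (p :: nat)" and ord: "Coset.order G = p ^ j" "j > 0"
  obtains z where "z \<in> carrier G" "z \<noteq> \<one>" "\<And>g. g \<in> carrier G \<Longrightarrow> g \<otimes> z = z \<otimes> g"
proof -
  define \<phi> where "\<phi> g = (\<lambda>h\<in>carrier G. g \<otimes> h \<otimes> inv g)" for g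
  interpret A: group_action G "carrier G" \<phi>
    using action_by_conjugation by (simp add: \<phi>_def[abs_def])
  have fin: "finite (carrier G)"
    using ord p by (metis order_gt_0_iff_finite prime_gt_0_nat zero_less_power)
  define Os where "Os = orbits G (carrier G) \<phi>"
  have Os: "finite Os" by (simp add: Os_def orbits_def fin)
  have "orbit G \<phi> \<one> = (\<lambda>g. \<phi> g \<one>) ` carrier G" by (auto simp: orbit_def)
  also have "\<dots> = (\<lambda>g. \<one>) ` carrier G" by (intro image_cong) (auto simp: \<phi>_def)
  finally have one: "orbit G \<phi> \<one> = {\<one>}" by auto
  hence oneOs: "{\<one>} \<in> Os" by (auto simp: Os_def orbits_def intro!: exI[of _ "\<one>"])
  have "p ^ j = (\<Sum>Orb\<in>Os. card Orb)"
    using A.disjoint_sum[OF fin, of "\<lambda>_. 1 :: nat"] ord by (simp add: Os_def Coset.order_def)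
  also have "\<dots> = card {\<one>} + (\<Sum>Orb\<in>Os - {{\<one>}}. card Orb)"
    by (rule sum.remove[OF Os oneOs])
  finally have sum: "p ^ j = 1 + (\<Sum>Orb\<in>Os - {{\<one>}}. card Orb)" by simp
  have "\<exists>Orb\<in>Os - {{\<one>}}. \<not> p dvd card Orb"
  proof (rule ccontr)
    assume "\<not> ?thesis"
    hence "p dvd (\<Sum>Orb\<in>Os - {{\<one>}}. card Orb)" by (intro dvd_sum) auto
    moreover have "p dvd p ^ j" using ord by simp
    ultimately have "p dvd 1" using sum dvd_add_left_iff[of p "\<Sum>Orb\<in>Os - {{\<one>}}. card Orb" 1] by simp
    thus False using p not_prime_unit by blast
  qed
  then obtain z where z: "z \<in> carrier G" "orbit G \<phi> z \<noteq> {\<one>}" "\<not> p dvd card (orbit G \<phi> z)"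
    by (auto simp: Os_def orbits_def)
  have "card (orbit G \<phi> z) dvd p ^ j"
    using A.orbit_stabilizer_theorem[OF z(1)] ord by (metis dvd_triv_left)
  then obtain i where i: "card (orbit G \<phi> z) = p ^ i" using p by (auto simp: divides_primepow_nat)
  hence "card (orbit G \<phi> z) = 1" using z(3) by (cases i) auto
  then obtain y where y: "orbit G \<phi> z = {y}" by (auto simp: card_1_singleton_iff)
  have "z \<in> orbit G \<phi> z" using A.orbit_refl[OF z(1)] .
  hence orb: "orbit G \<phi> z = {z}" using y by auto
  have "g \<otimes> z = z \<otimes> g" if g: "g \<in> carrier G" for g
  proof -
    have "\<phi> g z \<in> orbit G \<phi> z" using g by (auto simp: orbit_def)
    hence "g \<otimes> z \<otimes> inv g = z" using orb z(1) by (simp add: \<phi>_def)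
    thus ?thesis using g z(1) by (metis inv_closed inv_inv inv_solve_right m_closed)
  qed
  moreover have "z \<noteq> \<one>" using z(2) orb by auto
  ultimately show thesis using z(1) that by metis
qed

text \<open>An element that is central modulo the kernel acts as a scalar whose order is a power of \<open>p\<close>,
  and the only real root of unity of odd order is 1.\<close>
lemma Irr_not_real:
  assumes p: "Factorial_Ring.prime (p :: nat)" "odd p" and ord: "Coset.order G = p ^ m"
    and \<chi>: "\<chi> \<in> Irr G" "char_ker G \<chi> \<noteq> carrier G"
  shows "\<exists>g\<in>carrier G. cnj (\<chi> g) \<noteq> \<chi> g"
proof -
  have fin: "finite (carrier G)"
    using ord p by (metis order_gt_0_iff_finite prime_gt_0_nat zero_less_power)
  obtain \<rho> where \<rho>: "is_irreducible_representation G (char_degree G \<chi>) \<rho>" "\<chi> = character_of G \<rho>"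
    "\<And>g. g \<in> carrier G \<Longrightarrow> \<chi> g = mtrace (\<rho> g)"
    using IrrE'[OF \<chi>(1)] by metis
  define n where "n = char_degree G \<chi>"
  have irr: "is_irreducible_representation G n \<rho>" using \<rho> by (simp add: n_def)
  note rep = irreducible_repD(1)[OF irr]
  note r = repD[OF rep]
  define K where "K = char_ker G \<chi>"
  have K: "K = {g \<in> carrier G. \<rho> g = 1\<^sub>m n}"
    unfolding K_def \<rho>(2) by (rule char_ker_character_of[OF fin rep])
  interpret K: normal K G unfolding K_def by (rule char_ker_normal[OF fin \<chi>(1)])
  interpret Q: group "G Mod K" by (rule K.factorgroup_is_group)
  have oQ: "Coset.order (G Mod K) * card K = p ^ m"
    using lagrange[OF K.subgroup_axioms] ord by (simp add: Coset.order_def FactGroup_def)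
  then obtain j where j: "Coset.order (G Mod K) = p ^ j"
    using p(1) by (metis divides_primepow_nat dvd_triv_left)
  have "j > 0"
  proof (rule ccontr)
    assume "\<not> j > 0"
    hence "card K = card (carrier G)" using oQ j ord by (simp add: Coset.order_def)
    hence "K = carrier G" using fin K.subset by (intro card_seteq) auto
    thus False using \<chi>(2) by (simp add: K_def)
  qed
  obtain Z where Z: "Z \<in> carrier (G Mod K)" "Z \<noteq> \<one>\<^bsub>G Mod K\<^esub>"
    "\<And>g. g \<in> carrier (G Mod K) \<Longrightarrow> g \<otimes>\<^bsub>G Mod K\<^esub> Z = Z \<otimes>\<^bsub>G Mod K\<^esub> g"
    using Q.nontrivial_center_p_group[OF p(1) j \<open>j > 0\<close>] by metis
  obtain z where z: "z \<in> carrier G" "Z = K #> z" using Z(1) by (auto simp: FactGroup_def RCOSETS_def)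
  have "z \<notin> K" using Z(2) z coset_join2[OF z(1) K.subgroup_axioms] by auto
  \<comment> \<open>\<open>g \<otimes> z\<close> and \<open>z \<otimes> g\<close> differ by a factor
    in \<open>K\<close>, on which \<open>\<rho>\<close> is trivial.\<close>
  have "\<rho> g * \<rho> z = \<rho> z * \<rho> g" if g: "g \<in> carrier G" for g
  proof -
    have "(K #> g) <#> (K #> z) = (K #> z) <#> (K #> g)"
      using Z(3)[of "K #> g"] g z(2) by (auto simp: FactGroup_def RCOSETS_def)
    hence "K #> (g \<otimes> z) = K #> (z \<otimes> g)" using K.rcos_sum g z(1) by simp
    hence "g \<otimes> z \<in> K #> (z \<otimes> g)"
      using rcos_self[of "g \<otimes> z" K] g z(1) K.subgroup_axioms by simp
    then obtain k where k: "k \<in> K" "g \<otimes> z = k \<otimes> (z \<otimes> g)" by (auto simp: r_coset_def)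
    have kK: "k \<in> carrier G" "\<rho> k = 1\<^sub>m n" using k(1) unfolding K by auto
    have zg: "z \<otimes> g \<in> carrier G" using g z(1) by simp
    have "\<rho> (g \<otimes> z) = \<rho> k * \<rho> (z \<otimes> g)" unfolding k(2) by (rule r(2)[OF kK(1) zg])
    also have "\<dots> = \<rho> (z \<otimes> g)" using kK(2) r(1)[OF zg] by simp
    finally show ?thesis using r(2)[OF g z(1)] r(2)[OF z(1) g] by simp
  qed
  from schur_scalar[OF irr r(1)[OF z(1)] this] obtain c where c: "\<rho> z = c \<cdot>\<^sub>m 1\<^sub>m n" by metis
  have n: "n > 0" by (rule irreducible_repD(2)[OF irr])
  have pow: "\<rho> z ^\<^sub>m k = (c ^ k) \<cdot>\<^sub>m 1\<^sub>m n" for k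
    unfolding c by (induction k) (auto intro!: eq_matI simp: mult_smult_distrib[of _ n n _ n])
  have "\<rho> z ^\<^sub>m (p ^ m) = 1\<^sub>m n"
    using rep_pow[OF rep z(1), of "p ^ m"] pow_order_eq_1[OF z(1)] ord r(3) by simp
  hence "((c ^ (p ^ m)) \<cdot>\<^sub>m 1\<^sub>m n) $$ (0, 0) = (1\<^sub>m n :: complex mat) $$ (0, 0)" using pow by simp
  hence c1: "c ^ (p ^ m) = 1" using n by simp
  have "c \<noteq> 1"
  proof
    assume "c = 1"
    hence "\<rho> z = 1\<^sub>m n" unfolding c by (intro eq_matI) auto
    thus False using \<open>z \<notin> K\<close> z(1) unfolding K by blast
  qed
  have "\<not> cnj c = c"
  proof
    assume "cnj c = c"
    then obtain x :: real where x: "c = of_real x"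
      by (metis Reals_cnj_iff Reals_cases)
    hence "x ^ (p ^ m) = 1" using c1 by (metis of_real_1 of_real_eq_iff of_real_power)
    moreover have "odd (p ^ m)" using p(2) by simp
    ultimately have "x = 1" by (metis odd_pos odd_real_root_power_cancel real_root_one)
    thus False using x \<open>c \<noteq> 1\<close> by simp
  qed
  moreover have "\<chi> z = of_nat n * c"
    using \<rho>(3)[OF z(1)] c mtrace_smult[of "1\<^sub>m n" n c] by simp
  ultimately have "cnj (\<chi> z) \<noteq> \<chi> z" using n by simp
  thus ?thesis using z(1) by blast
qed

text \<open>Conjugating all matrix entries respects products, and conjugating vectors carries the
  invariant subspaces of one representation to those of the other.\<close>

lemma cnj_character_in_Irr:
  assumes "\<chi> \<in> Irr G"
  shows "(\<lambda>g\<in>carrier G. cnj (\<chi> g)) \<in> Irr G"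
proof -
  obtain n \<rho> where \<rho>: "is_irreducible_representation G n \<rho>" "\<chi> = character_of G \<rho>"
    using IrrE[OF assms] by metis
  note r = repD[OF irreducible_repD(1)[OF \<rho>(1)]]
  define \<sigma> where "\<sigma> g = map_mat cnj (\<rho> g)" for g
  have mult_vec: "map_vec cnj (A *\<^sub>v v) = map_mat cnj A *\<^sub>v map_vec cnj v"
    if "A \<in> carrier_mat n n" "v \<in> carrier_vec n" for A v
    using that by (intro eq_vecI) (auto simp: scalar_prod_def)
  have "is_irreducible_representation G n \<sigma>"
    unfolding is_irreducible_representation_def is_representation_iff[OF is_group] subspace_module_vec_iff
  proof (intro conjI ballI allI impI)
    show "\<sigma> (g \<otimes> h) = \<sigma> g * \<sigma> h" if "g \<in> carrier G" "h \<in> carrier G" for g h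
      using r(1)[OF that(1)] r(1)[OF that(2)] r(2)[OF that]
      by (intro eq_matI) (auto simp: \<sigma>_def scalar_prod_def)
    show "\<sigma> \<one> = 1\<^sub>m n" using r(3) by (intro eq_matI) (auto simp: \<sigma>_def)
    show "n > 0" by (rule irreducible_repD(2)[OF \<rho>(1)])
    fix W assume W: "W \<subseteq> carrier_vec n \<and> 0\<^sub>v n \<in> W \<and> (\<forall>v\<in>W. \<forall>w\<in>W. v + w \<in> W) \<and> (\<forall>c. \<forall>v\<in>W. c \<cdot>\<^sub>v v \<in> W)"
      and inv: "\<forall>g\<in>carrier G. \<forall>w\<in>W. \<sigma> g *\<^sub>v w \<in> W"
    \<comment> \<open>Conjugation is merely semilinear, but \<open>V\<close> is a complex subspace
      because \<open>W\<close> is closed under every scalar, conjugates included.\<close>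
    define V where "V = {v \<in> carrier_vec n. map_vec cnj v \<in> W}"
    have idem: "map_vec cnj (map_vec cnj v) = v" for v by (intro eq_vecI) auto
    have "V = {0\<^sub>v n} \<or> V = carrier_vec n"
    proof (rule invariant_subspace_cases[OF \<rho>(1)])
      have "map_vec cnj (0\<^sub>v n) = 0\<^sub>v n" by (intro eq_vecI) auto
      thus "0\<^sub>v n \<in> V" using W by (simp add: V_def)
      show "v + w \<in> V" if "v \<in> V" "w \<in> V" for v w
      proof -
        have "map_vec cnj (v + w) = map_vec cnj v + map_vec cnj w"
          using that by (intro eq_vecI) (auto simp: V_def)
        thus ?thesis using that W by (simp add: V_def)
      qed
      show "c \<cdot>\<^sub>v v \<in> V" if "v \<in> V" for c v
      proof -
        have "map_vec cnj (c \<cdot>\<^sub>v v) = cnj c \<cdot>\<^sub>v map_vec cnj v"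
          using that by (intro eq_vecI) (auto simp: V_def)
        thus ?thesis using that W by (simp add: V_def)
      qed
      show "\<rho> g *\<^sub>v w \<in> V" if g: "g \<in> carrier G" and w: "w \<in> V" for g w
        using mult_vec[OF r(1)[OF g], of w] w inv g r(1)[OF g] by (simp add: V_def \<sigma>_def)
    qed (auto simp: V_def)
    moreover have "W = map_vec cnj ` V"
    proof
      show "W \<subseteq> map_vec cnj ` V"
      proof
        fix w assume "w \<in> W"
        hence "map_vec cnj w \<in> V" using W by (auto simp: V_def idem)
        thus "w \<in> map_vec cnj ` V" using idem by (metis image_eqI)
      qed
    qed (auto simp: V_def)
    moreover have "map_vec cnj ` {0\<^sub>v n} = {0\<^sub>v n}" by (auto simp: vec_eq_iff)
    moreover have "map_vec cnj ` carrier_vec n = carrier_vec n"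
    proof
      show "carrier_vec n \<subseteq> map_vec cnj ` carrier_vec n"
      proof
        fix v :: "complex vec" assume "v \<in> carrier_vec n"
        thus "v \<in> map_vec cnj ` carrier_vec n" using idem[of v] by (intro image_eqI[of _ _ "map_vec cnj v"]) auto
      qed
    qed auto
    ultimately show "W = {0\<^sub>v n} \<or> W = carrier_vec n" by auto
  qed (use r(1) in \<open>auto simp: \<sigma>_def\<close>)
  hence "character_of G \<sigma> \<in> Irr G" by (rule character_of_in_Irr)
  moreover have "mtrace (\<sigma> g) = cnj (mtrace (\<rho> g))" if "g \<in> carrier G" for g
    using r(1)[OF that] by (auto simp: mtrace_def \<sigma>_def)
  hence "character_of G \<sigma> = (\<lambda>g\<in>carrier G. cnj (\<chi> g))"
    unfolding \<rho>(2) by (auto simp: character_of_def sum_list_diag_mat)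
  ultimately show ?thesis by simp
qed

text \<open>Complex conjugation pairs off the characters of a given degree; \<open>d > 1\<close>
  keeps away the trivial character, which it fixes.\<close>

lemma even_card_Irr_of_degree:
  assumes p: "Factorial_Ring.prime (p :: nat)" "odd p" and ord: "Coset.order G = p ^ m" and d: "d > 1"
  shows "even (card {\<chi> \<in> Irr G. char_degree G \<chi> = d})"
proof -
  have fin: "finite (carrier G)"
    using ord p by (metis order_gt_0_iff_finite prime_gt_0_nat zero_less_power)
  define f where "f \<chi> = (\<lambda>g\<in>carrier G. cnj (\<chi> g))" for \<chi> :: "'a \<Rightarrow> complex"
  show ?thesis
  proof (rule even_card_if_fixpoint_free_involution[of _ f])
    show "finite {\<chi> \<in> Irr G. char_degree G \<chi> = d}" using finite_Irr[OF fin] by simp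
    fix \<chi> assume "\<chi> \<in> {\<chi> \<in> Irr G. char_degree G \<chi> = d}"
    hence \<chi>: "\<chi> \<in> Irr G" "char_degree G \<chi> = d" by auto
    show "f \<chi> \<in> {\<chi> \<in> Irr G. char_degree G \<chi> = d}"
      using cnj_character_in_Irr[OF \<chi>(1)] \<chi>(2) by (simp add: f_def char_degree_def)
    \<comment> \<open>Equality outside the carrier holds because irreducible characters are
      undefined there.\<close>
    show "f (f \<chi>) = \<chi>"
      using Irr_extensional[OF \<chi>(1)] by (auto simp: f_def extensional_def)
    \<comment> \<open>With full kernel the index would be 1, too small to exceed the square of a
      degree.\<close>
    have "char_ker G \<chi> \<noteq> carrier G"
    proof
      assume "char_ker G \<chi> = carrier G"
      moreover have "card (rcosets (carrier G)) * Coset.order G = Coset.order G"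
        using lagrange[OF subgroup_self] by (simp add: Coset.order_def)
      moreover have "Coset.order G > 0" using fin by (simp add: order_gt_0_iff_finite)
      ultimately have "card (rcosets (char_ker G \<chi>)) = 1" by simp
      moreover have "\<chi> \<noteq> (\<lambda>g\<in>carrier G. 1)" using trivial_character(2) \<chi>(2) d by auto
      ultimately show False
        using char_degree_square_less[OF fin \<chi>(1)] \<chi>(2) d by simp
    qed
    then obtain g where "g \<in> carrier G" "cnj (\<chi> g) \<noteq> \<chi> g"
      using Irr_not_real[OF p ord \<chi>(1)] by auto
    thus "f \<chi> \<noteq> \<chi>" by (metis f_def restrict_apply')
  qed
qed

end

section \<open>Groups with the pseudo-algebra of an abelian p-group\<close>

context group
begin

lemma index_dvd_order:
  assumes "subgroup N G"
  shows "card (rcosets N) dvd Coset.order G"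
  using lagrange[OF assms] by (metis dvd_triv_left)

text \<open>Lets the pseudo-algebra determine the number of irreducible characters: the fibres of
  \<open>cod G\<close> partition \<open>Irr G\<close>.\<close>

lemma card_Irr_eq_sum_cod_multiplicity:
  assumes "finite (carrier G)"
  shows "card (Irr G) = (\<Sum>d\<in>Cod G. cod_multiplicity G d)"
  using sum.image_gen[OF finite_Irr[OF assms], of "\<lambda>_. 1 :: nat" "cod G"]
  by (simp add: Cod_def cod_multiplicity_def)

text \<open>A linear character is multiplicative with values among the \<open>e\<close>-th roots of
  unity, and the index of its kernel is the number of its values.\<close>

lemma linear_char_index_le:
  assumes fin: "finite (carrier G)" and \<chi>: "\<chi> \<in> Irr G" "char_degree G \<chi> = 1"
    and e: "e > 0" "\<And>x. x \<in> carrier G \<Longrightarrow> x [^] (e :: nat) = \<one>"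
  shows "card (rcosets (char_ker G \<chi>)) \<le> e"
proof -
  obtain \<rho> where \<rho>: "is_irreducible_representation G 1 \<rho>" "\<And>g. g \<in> carrier G \<Longrightarrow> \<chi> g = mtrace (\<rho> g)"
    using IrrE'[OF \<chi>(1)] \<chi>(2) by metis
  note r = repD[OF irreducible_repD(1)[OF \<rho>(1)]]
  have entry: "\<chi> g = \<rho> g $$ (0, 0)" if "g \<in> carrier G" for g
    using \<rho>(2)[OF that] carrier_matD(1)[OF r(1)[OF that]] by (simp add: mtrace_def)
  have mult: "\<chi> (g \<otimes> h) = \<chi> g * \<chi> h" if "g \<in> carrier G" "h \<in> carrier G" for g h
    using that r(2)[OF that] mult_mat_entry[OF r(1)[OF that(1)] r(1)[OF that(2)], of 0 0] by (simp add: entry)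
  have one: "\<chi> \<one> = 1" using r(3) by (simp add: entry)
  have pow: "\<chi> (g [^] (k :: nat)) = \<chi> g ^ k" if "g \<in> carrier G" for g k
    by (induction k) (use that one mult in auto)
  have "card (rcosets (char_ker G \<chi>)) = card (\<chi> ` carrier G)"
  proof (rule card_rcosets_eq_card_image)
    show "subgroup (char_ker G \<chi>) G"
      by (rule normal_imp_subgroup[OF char_ker_normal[OF fin \<chi>(1)]])
    fix x y assume x: "x \<in> carrier G" and y: "y \<in> carrier G"
    have "\<chi> y * \<chi> (inv y) = 1" using mult[OF y inv_closed[OF y]] one y by simp
    hence "\<chi> x = \<chi> y \<longleftrightarrow> \<chi> x * \<chi> (inv y) = 1"
      by (metis mult.commute mult.left_commute mult.right_neutral)
    thus "\<chi> x = \<chi> y \<longleftrightarrow> x \<otimes> inv y \<in> char_ker G \<chi>"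
      using x y mult[OF x inv_closed[OF y]] one by (simp add: char_ker_def)
  qed
  also have "\<dots> \<le> card {z :: complex. z ^ e = 1}"
  proof (rule card_mono)
    show "\<chi> ` carrier G \<subseteq> {z. z ^ e = 1}" using pow[of _ e] e(2) one by auto
  qed (use e in \<open>auto intro: finite_roots_unity\<close>)
  also have "\<dots> = e" using e(1) by (rule card_roots_unity_eq)
  finally show ?thesis .
qed

end

text \<open>Every \<open>\<rho> g\<close> commutes with the whole representation, so it is a scalar
  and every subspace is invariant.\<close>

lemma (in comm_group) char_degree_eq_1:
  assumes \<chi>: "\<chi> \<in> Irr G"
  shows "char_degree G \<chi> = 1"
proof -
  obtain \<rho> where \<rho>: "is_irreducible_representation G (char_degree G \<chi>) \<rho>"
    using IrrE'[OF \<chi>] by metis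
  define n where "n = char_degree G \<chi>"
  note irr = \<rho>[folded n_def]
  note r = repD[OF irreducible_repD(1)[OF irr]]
  have scalar: "\<exists>c. \<rho> g = c \<cdot>\<^sub>m 1\<^sub>m n" if g: "g \<in> carrier G" for g
    using schur_scalar[OF irr r(1)[OF g]] r(2) g m_comm by metis
  \<comment> \<open>The first coordinate axis, a proper subspace as soon as
    \<open>n > 1\<close>.\<close>
  define W where "W = {v \<in> carrier_vec n. \<forall>i<n. i \<noteq> 0 \<longrightarrow> v $ i = (0 :: complex)}"
  have "W = {0\<^sub>v n} \<or> W = carrier_vec n"
  proof (rule invariant_subspace_cases[OF irr])
    fix g w assume g: "g \<in> carrier G" and w: "w \<in> W"
    then obtain c where "\<rho> g = c \<cdot>\<^sub>m 1\<^sub>m n" using scalar by auto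
    moreover have "c \<cdot>\<^sub>m 1\<^sub>m n *\<^sub>v w = c \<cdot>\<^sub>v w" using w by (intro eq_vecI) (auto simp: W_def)
    moreover have "c \<cdot>\<^sub>v w \<in> W" using w by (auto simp: W_def)
    ultimately show "\<rho> g *\<^sub>v w \<in> W" by simp
  qed (auto simp: W_def)
  moreover have n: "n > 0" by (rule irreducible_repD(2)[OF irr])
  have "unit_vec n 0 \<in> W" "unit_vec n 0 \<noteq> (0\<^sub>v n :: complex vec)"
    using n by (auto simp: W_def)
  hence "W \<noteq> {0\<^sub>v n}" by auto
  ultimately have W: "W = carrier_vec n" by auto
  have "\<not> n > 1"
  proof
    assume "n > 1"
    hence "unit_vec n 1 \<notin> W" by (auto simp: W_def)
    thus False using W by simp
  qed
  thus ?thesis using n by (simp add: n_def)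
qed

section \<open>Arithmetic of the degree count\<close>

lemma eq_prime_power_if_unique_prime_divisor:
  fixes p n :: nat
  assumes p: "Factorial_Ring.prime p" and n: "n > 0"
    and uniq: "\<And>q. Factorial_Ring.prime q \<Longrightarrow> q dvd n \<Longrightarrow> q = p"
  shows "\<exists>k. n = p ^ k"
proof -
  have "\<not> is_unit p" using p not_prime_unit by blast
  define r where "r = n div p ^ multiplicity p n"
  have r: "n = p ^ multiplicity p n * r" "\<not> p dvd r"
    using multiplicity_decompose[OF _ \<open>\<not> is_unit p\<close>, of n] n by (simp_all add: r_def multiplicity_dvd)
  have "r = 1"
  proof (rule ccontr)
    assume "r \<noteq> 1"
    then obtain q where "Factorial_Ring.prime q" "q dvd r" using prime_factor_nat by blast
    moreover from this have "q dvd n" by (subst r(1)) simp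
    ultimately show False using uniq[of q] r(2) by simp
  qed
  thus ?thesis using r(1) by auto
qed

lemma degree_count_contradiction:
  fixes p x0 x1 x2 :: nat
  assumes p: "odd p" "p > 1" and ev: "even x1" "even x2" and pos: "x0 > 0" "x1 + x2 > 0"
    and k: "x0 + x1 + x2 = p ^ n" and ord: "x0 + p\<^sup>2 * x1 + p ^ 4 * x2 = p ^ m"
  shows False
proof -
  \<comment> \<open>The two counts differ by \<open>(p\<^sup>2 - 1) x1 + (p ^ 4 - 1) x2\<close>;
    \<open>T\<close> is what remains after division by \<open>p\<^sup>2 - 1\<close>.\<close>
  define T where "T = x1 + (p\<^sup>2 + 1) * x2"
  have evT: "even T" using ev by (simp add: T_def)
  have p2: "p\<^sup>2 > 1" and p4: "p ^ 4 > 1" using one_less_power[OF p(2)] by simp_all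
  have eq: "int p ^ m - int p ^ n = (int p ^ 2 - 1) * int T"
  proof -
    have "int p ^ m - int p ^ n = int (x0 + p\<^sup>2 * x1 + p ^ 4 * x2) - int (x0 + x1 + x2)"
      unfolding k ord by simp
    thus ?thesis by (simp add: T_def algebra_simps power2_eq_square power4_eq_xxxx)
  qed
  have "p ^ n < p ^ m"
  proof -
    have "T > 0" using pos by (auto simp: T_def)
    hence "(int p ^ 2 - 1) * int T > 0" using p2 by (intro mult_pos_pos) (simp_all flip: of_nat_power)
    thus ?thesis using eq by (simp flip: of_nat_power)
  qed
  hence "n < m" using p by simp
  \<comment> \<open>Replacing every weight by \<open>p ^ 4\<close> multiplies the number of
    characters by \<open>p ^ 4\<close>; the increase is strict because
    \<open>x0 > 0\<close>.\<close>
  have "p ^ m < p ^ (n + 4)"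
  proof -
    have "p\<^sup>2 \<le> p ^ 4" using p by (intro power_increasing) auto
    hence "p\<^sup>2 * x1 \<le> p ^ 4 * x1" by simp
    moreover have "x0 < p ^ 4 * x0" using pos p4 by simp
    ultimately have "p ^ m < p ^ 4 * (x0 + x1 + x2)" unfolding ord[symmetric] distrib_left by linarith
    thus ?thesis unfolding k by (simp add: power_add mult.commute)
  qed
  hence "m < n + 4" using p by simp
  have oddn: "odd (int p ^ n)" using p by simp
  have nz: "int p - 1 \<noteq> 0" using p by simp
  \<comment> \<open>In each case a factor of \<open>p\<^sup>2 - 1\<close> cancels, and an odd number
    is left equal to a multiple of the even number \<open>T\<close>.\<close>
  consider "m = n + 1" | "m = n + 2" | "m = n + 3" using \<open>n < m\<close> \<open>m < n + 4\<close> by linarith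
  thus False
  proof cases
    case 1
    have "(int p - 1) * int p ^ n = (int p - 1) * ((int p + 1) * int T)"
      using eq by (simp add: \<open>m = n + 1\<close> algebra_simps power2_eq_square)
    hence "int p ^ n = (int p + 1) * int T" using nz by simp
    moreover have "even ((int p + 1) * int T)" using evT by simp
    ultimately show False using oddn by argo
  next
    case 2
    have "(int p ^ 2 - 1) * int p ^ n = (int p ^ 2 - 1) * int T"
      using eq by (simp add: \<open>m = n + 2\<close> algebra_simps power2_eq_square)
    moreover have "int p ^ 2 - 1 \<noteq> 0" 
    proof -
      have "int (p\<^sup>2) > 1" using p2 by linarith
      thus ?thesis by simp
    qed
    ultimately have "int p ^ n = int T" by simp
    moreover have "even (int T)" using evT by simp
    ultimately show False using oddn by argo
  next
    case 3
    have "(int p - 1) * (int p ^ n * (int p ^ 2 + int p + 1)) = (int p - 1) * ((int p + 1) * int T)"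
      using eq by (simp add: \<open>m = n + 3\<close> algebra_simps power_add power2_eq_square power3_eq_cube)
    hence "int p ^ n * (int p ^ 2 + int p + 1) = (int p + 1) * int T" using nz by simp
    moreover have "odd (int p ^ n * (int p ^ 2 + int p + 1))" using p by simp
    moreover have "even ((int p + 1) * int T)" using evT by simp
    ultimately show False by argo
  qed
qed

section \<open>Codegrees and multiplicities recovered from the pseudo-algebra\<close>

lemma Cod_eq_fst_group_pseudo_algebra: "Cod G = fst ` group_pseudo_algebra G"
  by (force simp: group_pseudo_algebra_def)

lemma group_pseudo_algebra_eqD:
  assumes "group_pseudo_algebra G = group_pseudo_algebra A"
  shows "Cod G = Cod A" and "d \<in> Cod G \<Longrightarrow> cod_multiplicity G d = cod_multiplicity A d"
proof -
  show "Cod G = Cod A" using assms by (simp add: Cod_eq_fst_group_pseudo_algebra)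
  assume "d \<in> Cod G"
  hence "(d, cod_multiplicity G d) \<in> group_pseudo_algebra A"
    unfolding assms[symmetric] by (auto simp: group_pseudo_algebra_def)
  thus "cod_multiplicity G d = cod_multiplicity A d" by (auto simp: group_pseudo_algebra_def)
qed

theorem mainTheorem5:
  fixes p :: nat
    and G :: "('a, 'm) monoid_scheme"
    and A :: "('b, 'n) monoid_scheme"
  assumes "Factorial_Ring.prime p"
    and "group G" and "finite (carrier G)" and "\<not> comm_group G"
    and "comm_group A" and "finite (carrier A)" and "is_p_group p A"
    and "group_exponent A = p ^ 3"
    and "group_pseudo_algebra G = group_pseudo_algebra A"
  shows "p = 2"
proof (rule ccontr)
  assume "p \<noteq> 2"
  note p = assms(1) and finG = assms(3) and finA = assms(6)
  interpret G: group G by fact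
  interpret A: comm_group A by fact
  have podd: "odd p" and p1: "p > 1"
    using p \<open>p \<noteq> 2\<close> prime_odd_nat[of p] prime_gt_1_nat[of p] by auto
  obtain n where n: "Coset.order A = p ^ n" using assms(7) by (auto simp: is_p_group_def)
  \<comment> \<open>The exponent is a \<open>LEAST\<close> number and has its defining property once
    some number has it; the order of \<open>A\<close> does.\<close>
  have "\<exists>e. e > 0 \<and> (\<forall>x\<in>carrier A. x [^]\<^bsub>A\<^esub> (e :: nat) = \<one>\<^bsub>A\<^esub>)"
    using A.pow_order_eq_1 A.order_gt_0_iff_finite finA by blast
  from LeastI_ex[OF this] have exp: "\<And>x. x \<in> carrier A \<Longrightarrow> x [^]\<^bsub>A\<^esub> (p ^ 3) = \<one>\<^bsub>A\<^esub>"
    unfolding assms(8)[unfolded group_exponent_def] by blast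
  have codA: "\<exists>i\<le>3. cod A \<psi> = of_nat (p ^ i)" if \<psi>: "\<psi> \<in> Irr A" for \<psi>
  proof -
    have deg: "char_degree A \<psi> = 1" by (rule A.char_degree_eq_1[OF \<psi>])
    have sub: "subgroup (char_ker A \<psi>) A"
      by (rule normal_imp_subgroup[OF A.char_ker_normal[OF finA \<psi>]])
    have "card (rcosets\<^bsub>A\<^esub> (char_ker A \<psi>)) dvd p ^ n"
      using A.index_dvd_order[OF sub] unfolding n .
    then obtain i where i: "card (rcosets\<^bsub>A\<^esub> (char_ker A \<psi>)) = p ^ i"
      unfolding divides_primepow_nat[OF p] by blast
    have "p ^ i \<le> p ^ 3"
      unfolding i[symmetric] using p1 by (intro A.linear_char_index_le[OF finA \<psi> deg _ exp]) auto
    hence "i \<le> 3" using power_le_imp_le_exp[OF p1] by blast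
    moreover have "cod A \<psi> = of_nat (p ^ i)" using A.cod_times_char_degree[OF \<psi>] deg i by simp
    ultimately show ?thesis by blast
  qed
  have Cod: "Cod G = Cod A" by (rule group_pseudo_algebra_eqD(1)[OF assms(9)])
  have index: "\<exists>i\<le>3. card (rcosets\<^bsub>G\<^esub> (char_ker G \<chi>)) = char_degree G \<chi> * p ^ i" if \<chi>: "\<chi> \<in> Irr G" for \<chi>
  proof -
    have "cod G \<chi> \<in> Cod A" using \<chi> Cod by (auto simp: Cod_def)
    then obtain \<psi> where \<psi>: "\<psi> \<in> Irr A" "cod G \<chi> = cod A \<psi>" by (auto simp: Cod_def)
    obtain i where i: "i \<le> 3" "cod G \<chi> = of_nat (p ^ i)"
      using codA[OF \<psi>(1)] unfolding \<psi>(2)[symmetric] by blast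
    have "of_nat (card (rcosets\<^bsub>G\<^esub> (char_ker G \<chi>))) = (of_nat (char_degree G \<chi> * p ^ i) :: complex)"
      using G.cod_times_char_degree[OF \<chi>] i by (simp add: mult.commute)
    hence "card (rcosets\<^bsub>G\<^esub> (char_ker G \<chi>)) = char_degree G \<chi> * p ^ i" by (simp only: of_nat_eq_iff)
    with i(1) show ?thesis by blast
  qed
  have "q = p" if q: "Factorial_Ring.prime q" "q dvd Coset.order G" for q
  proof (rule ccontr)
    assume "q \<noteq> p"
    hence "\<not> q dvd p ^ i" for i
      using primes_dvd_imp_eq[OF q(1) p] prime_dvd_power[OF q(1), of p i] by blast
    hence "\<not> q dvd Coset.order G"
      using index by (intro G.not_prime_dvd_order[OF finG q(1)]) blast
    thus False using q(2) by simp
  qed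
  moreover have "Coset.order G > 0" using finG by (simp add: G.order_gt_0_iff_finite)
  ultimately obtain m where m: "Coset.order G = p ^ m"
    using eq_prime_power_if_unique_prime_divisor[OF p] by blast
  have degs: "char_degree G \<chi> \<in> {1, p, p\<^sup>2}" if \<chi>: "\<chi> \<in> Irr G" for \<chi>
  proof (cases "\<chi> = (\<lambda>g\<in>carrier G. 1)")
    case True
    thus ?thesis using G.trivial_character(2) by simp
  next
    case False
    obtain i where i: "i \<le> 3" "card (rcosets\<^bsub>G\<^esub> (char_ker G \<chi>)) = char_degree G \<chi> * p ^ i"
      using index[OF \<chi>] by auto
    \<comment> \<open>One positive factor, the degree, cancels from the bound on its square.\<close>
    have "char_degree G \<chi> < p ^ i"
      using G.char_degree_square_less[OF finG \<chi> False] i(2) G.Irr_one_eq_char_degree(2)[OF \<chi>]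
      by (simp add: power2_eq_square)
    also have "\<dots> \<le> p ^ 3" using i(1) p1 by (intro power_increasing) auto
    finally have less: "char_degree G \<chi> < p ^ 3" .
    have sub: "subgroup (char_ker G \<chi>) G"
      by (rule normal_imp_subgroup[OF G.char_ker_normal[OF finG \<chi>]])
    have "char_degree G \<chi> * p ^ i dvd p ^ m"
      using G.index_dvd_order[OF sub] unfolding m i(2) .
    hence "char_degree G \<chi> dvd p ^ m" by (rule dvd_mult_left)
    then obtain j where j: "char_degree G \<chi> = p ^ j"
      unfolding divides_primepow_nat[OF p] by blast
    hence "j < 3" using less p1 by simp
    hence "j = 0 \<or> j = 1 \<or> j = 2" by auto
    thus ?thesis using j by auto
  qed
  define D where "D d = {\<chi> \<in> Irr G. char_degree G \<chi> = d}" for d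
  have finI: "finite (Irr G)" by (rule G.finite_Irr[OF finG])
  have finD: "finite (D d)" for d using finI by (simp add: D_def)
  \<comment> \<open>Kept general in \<open>f\<close> to yield both counts: the constant 1 for the
    number of characters, the square for the order of \<open>G\<close>.\<close>
  have sum: "(\<Sum>\<chi>\<in>Irr G. f (char_degree G \<chi>)) = f 1 * card (D 1) + f p * card (D p) + f (p\<^sup>2) * card (D (p\<^sup>2))"
    for f :: "nat \<Rightarrow> nat"
  proof -
    have "Irr G = D 1 \<union> D p \<union> D (p\<^sup>2)" using degs by (auto simp: D_def)
    moreover have "D 1 \<inter> D p = {}" "(D 1 \<union> D p) \<inter> D (p\<^sup>2) = {}"
      using p1 by (auto simp: D_def power2_eq_square)
    moreover have "(\<Sum>\<chi>\<in>D d. f (char_degree G \<chi>)) = f d * card (D d)" for d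
      by (simp add: D_def)
    ultimately show ?thesis using finD by (simp add: sum.union_disjoint)
  qed
  have "card (Irr G) = card (Irr A)"
    unfolding G.card_Irr_eq_sum_cod_multiplicity[OF finG] A.card_Irr_eq_sum_cod_multiplicity[OF finA] Cod[symmetric]
    by (intro sum.cong refl) (rule group_pseudo_algebra_eqD(2)[OF assms(9)])
  \<comment> \<open>All degrees of \<open>A\<close> are 1, so its sum of squares is its number of
    characters.\<close>
  also have "\<dots> = p ^ n"
    using A.order_eq_sum_char_degree_squares[OF finA] n A.char_degree_eq_1 by simp
  finally have k: "card (D 1) + card (D p) + card (D (p\<^sup>2)) = p ^ n"
    using sum[of "\<lambda>_. 1"] by simp
  have ord: "card (D 1) + p\<^sup>2 * card (D p) + p ^ 4 * card (D (p\<^sup>2)) = p ^ m"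
    using sum[of "\<lambda>d. d\<^sup>2"] G.order_eq_sum_char_degree_squares[OF finG] m by (simp flip: power_mult)
  have "card (D 1) > 0"
    using G.trivial_character(1,2) finD[of 1] by (auto simp: card_gt_0_iff D_def)
  \<comment> \<open>Noncommutativity enters here: with all degrees equal to 1, \<open>G\<close>
    would be abelian.\<close>
  moreover have "card (D p) + card (D (p\<^sup>2)) > 0"
  proof (rule ccontr)
    assume "\<not> ?thesis"
    hence "D p = {}" "D (p\<^sup>2) = {}" using finD by auto
    hence "char_degree G \<chi> = 1" if "\<chi> \<in> Irr G" for \<chi> using degs[OF that] that by (auto simp: D_def)
    thus False using G.comm_group_if_linear[OF finG] assms(4) by blast
  qed
  moreover have "even (card (D p))" "even (card (D (p\<^sup>2)))"
    unfolding D_def using p1 one_less_power[OF p1, of 2]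
    by (intro G.even_card_Irr_of_degree[OF p podd m]; simp)+
  ultimately show False
    using degree_count_contradiction[OF podd p1 _ _ _ _ k ord] by simp
qed

end
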